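(* Let $G=G_1\times\dots\times G_k\times A$ be a finitely generated group, where $k\geq 0$, $A$ is free abelian, and each $G_i$ is directly indecomposable and has trivial centre. Let $\mathrm{Aut}^0(G)\leq\mathrm{Aut}(G)$ be the subgroup of automorphisms preserving each of the subgroups $\langle G_i,A\rangle$, $1\leq i\leq k$. For each $\varphi\in\mathrm{Aut}^0(G)$, there exist automorphisms $\varphi_i\in\mathrm{Aut}(G_i)$ such that, for each element $g=(g_1,\dots,g_k,a)\in G$, we have \[ |\varphi^n(g)|\sim\sum_{i=1}^k|\varphi_i^n(g_i)|+|\varphi_{\rm ab}^n(g_{\rm ab})| ,\qquad \|\varphi^n(g)\|\sim\sum_{i=1}^k\|\varphi_i^n(g_i)\|+|\varphi_{\rm ab}^n(g_{\rm ab})| . \] Moreover, for each $\varphi\in\mathrm{Aut}^0(G)$ and each $g\in G$, there exist an algebraic integer $\lambda\geq 1$ and $p\in\mathbb{N}$ with $|\varphi_{\rm ab}^n(g_{\rm ab})|\sim n^p\lambda^n$.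
   Context: For a finitely generated group $Q$, $|\cdot|$ denotes word length with respect to a fixed finite generating set of $Q$, and $\|q\|:=\min_{h\in Q}|hqh^{-1}|$ is the conjugacy length. The choice of generating sets is irrelevant below. For sequences $a,b\colon\mathbb{N}\to\mathbb{R}_{>0}$, write $a_n\preceq b_n$ if there is $C>0$ with $a_n\leq Cb_n$ for all $n\geq 0$, and $a_n\sim b_n$ if $a_n\preceq b_n$ and $b_n\preceq a_n$. The symbol $\sim$ in the claim refers to sequences indexed by $n$. By convention the growth rate of the identity element of a group is the class of the constant sequence $1$ (that is, the length $0$ of the identity is replaced by $1$), and the value of $n^p\lambda^n$ at $n=0$ is replaced by a positive number. $Q_{\rm ab}$ denotes the free part of the abelianisation of $Q$ (the abelianisation modulo its torsion subgroup). Every $\chi\in\mathrm{Aut}(Q)$ induces $\chi_{\rm ab}\in\mathrm{Aut}(Q_{\rm ab})$, and $q_{\rm ab}\in Q_{\rm ab}$ denotes the image of $q\in Q$. *)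

theory Defs
  imports "HOL-Algebra.Algebra" "HOL-Computational_Algebra.Polynomial"
begin

section \<open>Word length and conjugacy length\<close>

definition finite_generating_set :: "('a, 'm) monoid_scheme \<Rightarrow> 'a set \<Rightarrow> bool" where
  "finite_generating_set G S \<longleftrightarrow> finite S \<and> S \<subseteq> carrier G \<and> generate G S = carrier G"

definition finitely_generated :: "('a, 'm) monoid_scheme \<Rightarrow> bool" where
  "finitely_generated G \<longleftrightarrow> (\<exists>S. finite_generating_set G S)"

definition word_length :: "('a, 'm) monoid_scheme \<Rightarrow> 'a set \<Rightarrow> 'a \<Rightarrow> nat" where
  "word_length G S q =
     (LEAST m. \<exists>ws. length ws = m \<and> set ws \<subseteq> S \<union> m_inv G ` S \<and> foldr (\<lambda>x y. x \<otimes>\<^bsub>G\<^esub> y) ws \<one>\<^bsub>G\<^esub> = q)"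

definition conj_length :: "('a, 'm) monoid_scheme \<Rightarrow> 'a set \<Rightarrow> 'a \<Rightarrow> nat" where
  "conj_length G S q =
     (LEAST m. \<exists>h\<in>carrier G. m = word_length G S (h \<otimes>\<^bsub>G\<^esub> q \<otimes>\<^bsub>G\<^esub> inv\<^bsub>G\<^esub> h))"

text \<open>In growth rates the length \<open>0\<close> of the identity is replaced by \<open>1\<close>, so that all the
  sequences compared below are positive.\<close>

definition wlen :: "('a, 'm) monoid_scheme \<Rightarrow> 'a set \<Rightarrow> 'a \<Rightarrow> real" where
  "wlen G S q = (if q = \<one>\<^bsub>G\<^esub> then 1 else real (word_length G S q))"

definition clen :: "('a, 'm) monoid_scheme \<Rightarrow> 'a set \<Rightarrow> 'a \<Rightarrow> real" where
  "clen G S q = (if q = \<one>\<^bsub>G\<^esub> then 1 else real (conj_length G S q))"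

definition growth_le :: "(nat \<Rightarrow> real) \<Rightarrow> (nat \<Rightarrow> real) \<Rightarrow> bool" (infix \<open>\<preceq>\<close> 50) where
  "a \<preceq> b \<longleftrightarrow> (\<exists>C>0. \<forall>n. a n \<le> C * b n)"

definition growth_eq :: "(nat \<Rightarrow> real) \<Rightarrow> (nat \<Rightarrow> real) \<Rightarrow> bool" (infix \<open>\<simeq>\<close> 50) where
  "a \<simeq> b \<longleftrightarrow> a \<preceq> b \<and> b \<preceq> a"


section \<open>Properties of the factors\<close>

definition free_abelian :: "('a, 'm) monoid_scheme \<Rightarrow> bool" where
  "free_abelian A \<longleftrightarrow> group A \<and> (\<exists>B :: 'a set. A \<cong> free_Abelian_group B)"
  \<comment> \<open>Taking \<open>B\<close> in the type of the elements is no restriction: a basis is a subset of \<open>A\<close>.\<close>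

definition center :: "('a, 'm) monoid_scheme \<Rightarrow> 'a set" where
  "center G = {z \<in> carrier G. \<forall>x\<in>carrier G. z \<otimes>\<^bsub>G\<^esub> x = x \<otimes>\<^bsub>G\<^esub> z}"

text \<open>The trivial group counts as directly indecomposable here; as the notion is only used as a
  hypothesis, this is the more general convention.\<close>

definition directly_indecomposable :: "('a, 'm) monoid_scheme \<Rightarrow> bool" where
  "directly_indecomposable G \<longleftrightarrow>
     (\<forall>H K. subgroup H G \<and> subgroup K G \<and>
        (\<lambda>(x, y). x \<otimes>\<^bsub>G\<^esub> y) \<in> iso (G\<lparr>carrier := H\<rparr> \<times>\<times> G\<lparr>carrier := K\<rparr>) G \<longrightarrow>
        H = {\<one>\<^bsub>G\<^esub>} \<or> K = {\<one>\<^bsub>G\<^esub>})"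


section \<open>The free part of the abelianisation\<close>

definition abelianisation :: "('a, 'm) monoid_scheme \<Rightarrow> 'a set monoid" where
  "abelianisation G = G Mod derived G (carrier G)"

definition torsion :: "('a, 'm) monoid_scheme \<Rightarrow> 'a set" where
  "torsion G = {x \<in> carrier G. \<exists>n::nat. n > 0 \<and> x [^]\<^bsub>G\<^esub> n = \<one>\<^bsub>G\<^esub>}"

definition free_ab :: "('a, 'm) monoid_scheme \<Rightarrow> 'a set set monoid" where
  "free_ab G = abelianisation G Mod torsion (abelianisation G)"

definition ab_elem :: "('a, 'm) monoid_scheme \<Rightarrow> 'a \<Rightarrow> 'a set set" where
  "ab_elem G q =
     torsion (abelianisation G) #>\<^bsub>abelianisation G\<^esub> (derived G (carrier G) #>\<^bsub>G\<^esub> q)"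

text \<open>Elements of \<^term>\<open>free_ab G\<close> are cosets whose elements are cosets in \<open>G\<close>. An automorphism
  \<open>\<chi>\<close> of \<open>G\<close> maps cosets of characteristic subgroups to such cosets, hence the induced map takes
  images twice. The lemma \<open>ab_map_ab_elem\<close> is its characteristic property.\<close>

definition ab_map :: "('a \<Rightarrow> 'a) \<Rightarrow> 'a set set \<Rightarrow> 'a set set" where
  "ab_map \<chi> U = (\<lambda>C. \<chi> ` C) ` U"

lemma image_r_coset:
  assumes "f \<in> hom H H" "N \<subseteq> carrier H" "f ` N = N" "x \<in> carrier H"
  shows "f ` (N #>\<^bsub>H\<^esub> x) = N #>\<^bsub>H\<^esub> f x"
proof -
  have "f ` (N #>\<^bsub>H\<^esub> x) = (\<Union>h\<in>N. {f h \<otimes>\<^bsub>H\<^esub> f x})"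
    unfolding r_coset_def image_UN image_insert image_empty
    using assms by (intro SUP_cong) (auto simp: hom_mult)
  also have "\<dots> = (\<Union>h\<in>f ` N. {h \<otimes>\<^bsub>H\<^esub> f x})"
    by blast
  finally show ?thesis
    using assms(3) by (simp add: r_coset_def)
qed

lemma iso_FactGroup_image:
  fixes G (structure)
  assumes "N \<lhd> G" "f \<in> iso G G" "f ` N = N"
  shows "(\<lambda>C. f ` C) \<in> iso (G Mod N) (G Mod N)"
proof -
  interpret normal N G by fact
  have f: "f \<in> hom G G" "f ` carrier G = carrier G" "inj_on f (carrier G)"
    using assms(2) by (auto simp: iso_iff)
  have img: "f ` (N #> x) = N #> f x" if "x \<in> carrier G" for x
    using image_r_coset[OF f(1) subset assms(3) that] .
  have fc: "f x \<in> carrier G" if "x \<in> carrier G" for x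
    using f(1) that by (rule hom_in_carrier)
  have "(\<lambda>C. f ` C) \<in> hom (G Mod N) (G Mod N)"
  proof (rule homI)
    fix U assume "U \<in> carrier (G Mod N)"
    then show "f ` U \<in> carrier (G Mod N)"
      by (auto simp: carrier_FactGroup img fc)
  next
    fix U V assume "U \<in> carrier (G Mod N)" "V \<in> carrier (G Mod N)"
    then obtain x y where xy: "x \<in> carrier G" "y \<in> carrier G" "U = N #> x" "V = N #> y"
      by (auto simp: carrier_FactGroup)
    then show "f ` (U \<otimes>\<^bsub>G Mod N\<^esub> V) = f ` U \<otimes>\<^bsub>G Mod N\<^esub> f ` V"
      using f(1) by (simp add: rcos_sum img fc hom_mult)
  qed
  moreover have "(\<lambda>C. f ` C) ` carrier (G Mod N) = carrier (G Mod N)"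
  proof -
    have "(\<lambda>C. f ` C) ` carrier (G Mod N) = (\<lambda>x. N #> f x) ` carrier G"
      unfolding carrier_FactGroup image_image by (rule image_cong) (simp_all add: img)
    also have "\<dots> = (\<lambda>x. N #> x) ` (f ` carrier G)"
      by (simp add: image_image)
    finally show ?thesis
      by (simp add: f(2) carrier_FactGroup)
  qed
  moreover have "inj_on (\<lambda>C. f ` C) (carrier (G Mod N))"
  proof (rule inj_on_subset[OF inj_on_image_Pow[OF f(3)]])
    show "carrier (G Mod N) \<subseteq> Pow (carrier G)"
      using r_coset_subset_G[OF subset] by (auto simp: carrier_FactGroup)
  qed
  ultimately show ?thesis by (simp add: iso_iff)
qed

lemma iso_image_torsion:
  assumes "group H" "f \<in> iso H H"
  shows "f ` torsion H = torsion H"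
proof -
  have sub: "g ` torsion H \<subseteq> torsion H" if "g \<in> hom H H" for g
  proof
    fix y assume "y \<in> g ` torsion H"
    then obtain x n where x: "x \<in> carrier H" "y = g x" "(n::nat) > 0" "x [^]\<^bsub>H\<^esub> n = \<one>\<^bsub>H\<^esub>"
      by (auto simp: torsion_def)
    then have "y [^]\<^bsub>H\<^esub> n = \<one>\<^bsub>H\<^esub>"
      using hom_nat_pow[OF that x(1) assms(1) assms(1), of n] hom_one[OF that assms(1) assms(1)]
      by simp
    then show "y \<in> torsion H"
      using x that by (auto simp: torsion_def hom_in_carrier)
  qed
  let ?g = "inv_into (carrier H) f"
  have g: "?g \<in> iso H H"
    using group.iso_set_sym[OF assms] .
  have "torsion H \<subseteq> f ` torsion H"
  proof
    fix y assume y: "y \<in> torsion H"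
    then have "y \<in> f ` carrier H"
      using assms(2) by (auto simp: iso_iff torsion_def)
    then have "f (?g y) = y"
      by (rule f_inv_into_f)
    moreover have "?g y \<in> torsion H"
      using sub g y by (auto simp: iso_def)
    ultimately show "y \<in> f ` torsion H"
      by (metis imageI)
  qed
  moreover have "f ` torsion H \<subseteq> torsion H"
    using sub assms(2) by (simp add: iso_def)
  ultimately show ?thesis by blast
qed

lemma ab_map_ab_elem:
  fixes G (structure)
  assumes "group G" "\<chi> \<in> auto G" "q \<in> carrier G"
  shows "ab_map \<chi> (ab_elem G q) = ab_elem G (\<chi> q)"
proof -
  interpret group G by fact
  let ?D = "derived G (carrier G)"
  have hom: "\<chi> \<in> hom G G" and iso: "\<chi> \<in> iso G G"
    using assms(2) by (auto simp: auto_def Bij_def iso_def)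
  interpret \<chi>: group_hom G G \<chi>
    using hom by unfold_locales
  have D: "?D \<lhd> G" by (rule derived_self_is_normal)
  have \<chi>D: "\<chi> ` ?D = ?D"
    using \<chi>.derived_img[of "carrier G"] iso by (simp add: iso_iff)
  have DG: "?D \<subseteq> carrier G"
    by (rule derived_in_carrier) simp
  have isoH: "(\<lambda>C. \<chi> ` C) \<in> iso (abelianisation G) (abelianisation G)"
    unfolding abelianisation_def by (rule iso_FactGroup_image[OF D iso \<chi>D])
  have "group (abelianisation G)"
    unfolding abelianisation_def by (rule normal.factorgroup_is_group[OF D])
  note T = iso_image_torsion[OF this isoH]
  have "?D #> q \<in> carrier (abelianisation G)"
    using assms(3) by (simp add: abelianisation_def carrier_FactGroup)
  moreover have "torsion (abelianisation G) \<subseteq> carrier (abelianisation G)"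
    by (auto simp: torsion_def)
  moreover have "(\<lambda>C. \<chi> ` C) \<in> hom (abelianisation G) (abelianisation G)"
    using isoH by (simp add: iso_def)
  ultimately have "ab_map \<chi> (ab_elem G q) =
      torsion (abelianisation G) #>\<^bsub>abelianisation G\<^esub> (\<chi> ` (?D #> q))"
    unfolding ab_map_def ab_elem_def using T by (intro image_r_coset)
  also have "\<chi> ` (?D #> q) = ?D #> \<chi> q"
    by (rule image_r_coset[OF hom DG \<chi>D assms(3)])
  finally show ?thesis
    by (simp add: ab_elem_def)
qed


section \<open>The direct product and its automorphisms\<close>

text \<open>The factors \<open>G\<^sub>i\<close> share one element type. This is no restriction, since finitely many groups
  can be transported to a common type (a disjoint sum).\<close>

definition product_with :: "nat \<Rightarrow> (nat \<Rightarrow> 'a monoid) \<Rightarrow> 'b monoid \<Rightarrow> ((nat \<Rightarrow> 'a) \<times> 'b) monoid" where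
  "product_with k Gs A = product_group {1..k} Gs \<times>\<times> A"

definition factor :: "nat \<Rightarrow> (nat \<Rightarrow> 'a monoid) \<Rightarrow> 'b monoid \<Rightarrow> nat \<Rightarrow> ((nat \<Rightarrow> 'a) \<times> 'b) set" where
  "factor k Gs A i =
     (\<lambda>x. (\<lambda>j\<in>{1..k}. if j = i then x else \<one>\<^bsub>Gs j\<^esub>, \<one>\<^bsub>A\<^esub>)) ` carrier (Gs i)"

definition abelian_factor :: "nat \<Rightarrow> (nat \<Rightarrow> 'a monoid) \<Rightarrow> 'b monoid \<Rightarrow> ((nat \<Rightarrow> 'a) \<times> 'b) set" where
  "abelian_factor k Gs A = (\<lambda>a. (\<lambda>j\<in>{1..k}. \<one>\<^bsub>Gs j\<^esub>, a)) ` carrier A"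

definition Aut0 ::
    "nat \<Rightarrow> (nat \<Rightarrow> 'a monoid) \<Rightarrow> 'b monoid \<Rightarrow> ((nat \<Rightarrow> 'a) \<times> 'b \<Rightarrow> (nat \<Rightarrow> 'a) \<times> 'b) set" where
  "Aut0 k Gs A = {\<phi> \<in> auto (product_with k Gs A). \<forall>i\<in>{1..k}.
     \<phi> ` generate (product_with k Gs A) (factor k Gs A i \<union> abelian_factor k Gs A) =
       generate (product_with k Gs A) (factor k Gs A i \<union> abelian_factor k Gs A)}"

end

theory Submission
  imports Defs "Jordan_Normal_Form.Jordan_Normal_Form_Existence"
begin

text \<open>Write \<open>P = G\<^sub>1 \<times> \<dots> \<times> G\<^sub>k \<times> A\<close>.

  The two comparisons of lengths come from one principle: a homomorphism between finitely generated
  groups increases word lengths and conjugacy lengths by at most a constant factor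
  (\<open>hom_wlen_le\<close>, \<open>hom_clen_le\<close>). An element of \<open>P\<close> is therefore at least as long, up to a factor,
  as its coordinates in the \<open>G\<^sub>i\<close> and as its image in the free part \<open>P\<^sub>a\<^sub>b\<close> of the abelianisation.
  Conversely it is the product of its coordinates and of its component in \<open>A\<close>, and the latter is a
  homomorphic image of the class in \<open>P\<^sub>a\<^sub>b\<close>, because \<open>A\<close> is abelian and torsion-free. So along every
  sequence of elements of \<open>P\<close>, the length is equivalent to the sum of the lengths of these images.

  This makes the choice of the \<open>\<phi>\<^sub>i\<close> clear: the \<open>i\<close>-th coordinate of \<open>\<phi> g\<close> has to be a function of
  the \<open>i\<close>-th coordinate of \<open>g\<close>. It is (\<open>Aut0_component\<close>), since \<open>\<phi>\<close> maps \<open>G\<^sub>j\<close> into \<open>\<langle>G\<^sub>j, A\<rangle>\<close>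
  for \<open>j \<noteq> i\<close>, and maps \<open>A\<close>, which is the centre of \<open>P\<close>, to itself. The function is the
  automorphism that \<open>\<phi>\<close> induces on \<open>\<langle>G\<^sub>i, A\<rangle> / A\<close>.

  For the growth in \<open>P\<^sub>a\<^sub>b\<close>: a finitely generated torsion-free abelian group has a basis
  (\<open>ex_basis\<close>), in which the induced automorphism is a nonsingular integer matrix \<open>B\<close>, and word
  length is equivalent to the \<open>\<ell>\<^sup>1\<close>-norm of the coordinate vector (\<open>wlen_combination_growth\<close>). In
  Jordan normal form every block contributes either nothing or, up to bounded factors, some
  \<open>n\<^sup>p \<bar>\<mu>\<bar>\<^sup>n\<close> for its eigenvalue \<open>\<mu>\<close> (\<open>jordan_block_growth\<close>), and the fastest block wins.
  Finally \<open>\<lambda> = \<bar>\<mu>\<bar>\<close> is an algebraic integer because its square is an eigenvalue of the integer matrix \<open>B \<otimes> B\<close>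
  (\<open>norm_eigenvalue_algebraic_int\<close>), and \<open>\<lambda> \<ge> 1\<close> because nonzero integer vectors have norm at
  least \<open>1\<close>.\<close>

section \<open>Comparison of growth rates\<close>

lemma growth_leI: "C > 0 \<Longrightarrow> (\<And>n. a n \<le> C * b n) \<Longrightarrow> a \<preceq> b"
  unfolding growth_le_def by blast

lemma growth_le_trans [trans]:
  assumes "a \<preceq> b" "b \<preceq> c"
  shows "a \<preceq> c"
proof -
  obtain C where C: "C > 0" "\<And>n. a n \<le> C * b n"
    using assms(1) unfolding growth_le_def by blast
  obtain D where D: "D > 0" "\<And>n. b n \<le> D * c n"
    using assms(2) unfolding growth_le_def by blast
  have "a n \<le> (C * D) * c n" for n
  proof -
    have "a n \<le> C * b n" by (rule C)
    also have "\<dots> \<le> C * (D * c n)" using C(1) D(2) by (intro mult_left_mono) auto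
    finally show ?thesis by (simp add: mult.assoc)
  qed
  then show ?thesis using C(1) D(1) by (intro growth_leI[of "C * D"]) auto
qed

lemma growth_le_mono: "(\<And>n. a n \<le> b n) \<Longrightarrow> a \<preceq> b"
  by (rule growth_leI[of 1]) auto

lemma growth_le_add:
  assumes "a \<preceq> c" "b \<preceq> c"
  shows "(\<lambda>n. a n + b n) \<preceq> c"
proof -
  obtain C where C: "C > 0" "\<And>n. a n \<le> C * c n"
    using assms(1) unfolding growth_le_def by blast
  obtain D where D: "D > 0" "\<And>n. b n \<le> D * c n"
    using assms(2) unfolding growth_le_def by blast
  show ?thesis
    using C D by (intro growth_leI[of "C + D"]) (auto simp: distrib_right intro: add_mono)
qed

lemma growth_le_sum:
  assumes "\<And>i. i \<in> I \<Longrightarrow> a i \<preceq> c" "\<And>n. 0 \<le> c n"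
  shows "(\<lambda>n. \<Sum>i\<in>I. a i n) \<preceq> c"
  using assms(1)
proof (induction I rule: infinite_finite_induct)
  case (insert i I)
  then have "(\<lambda>n. a i n + (\<Sum>i\<in>I. a i n)) \<preceq> c"
    by (intro growth_le_add) auto
  then show ?case using insert by simp
qed (auto intro!: growth_le_mono assms(2))

lemma growth_eq_refl: "(a :: nat \<Rightarrow> real) \<simeq> a"
  unfolding growth_eq_def by (auto intro: growth_le_mono)

lemma growth_eq_trans: "(a :: nat \<Rightarrow> real) \<simeq> b \<Longrightarrow> (b :: nat \<Rightarrow> real) \<simeq> c \<Longrightarrow> a \<simeq> c"
  unfolding growth_eq_def using growth_le_trans by blast


section \<open>Word length and conjugacy length\<close>

context group
begin

lemma foldr_mult_closed:
  assumes "set ws \<subseteq> carrier G" "x \<in> carrier G"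
  shows "foldr (\<otimes>) ws x \<in> carrier G"
  using assms by (induction ws) auto

lemma foldr_mult_append:
  assumes "set us \<subseteq> carrier G" "set vs \<subseteq> carrier G"
  shows "foldr (\<otimes>) (us @ vs) \<one> = foldr (\<otimes>) us \<one> \<otimes> foldr (\<otimes>) vs \<one>"
  using assms by (induction us) (auto simp: foldr_mult_closed m_assoc)

lemma generate_imp_word:
  assumes "S \<subseteq> carrier G" "x \<in> generate G S"
  shows "\<exists>ws. set ws \<subseteq> S \<union> m_inv G ` S \<and> foldr (\<otimes>) ws \<one> = x"
  using assms(2)
proof induction
  case one
  show ?case by (rule exI[of _ "[]"]) auto
next
  case (incl h)
  then show ?case using assms(1) by (intro exI[of _ "[h]"]) auto
next
  case (inv h)
  then show ?case using assms(1) by (intro exI[of _ "[inv h]"]) auto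
next
  case (eng h1 h2)
  then obtain us vs where
    "set us \<subseteq> S \<union> m_inv G ` S" "foldr (\<otimes>) us \<one> = h1"
    "set vs \<subseteq> S \<union> m_inv G ` S" "foldr (\<otimes>) vs \<one> = h2" by blast
  moreover have "S \<union> m_inv G ` S \<subseteq> carrier G" using assms(1) by auto
  ultimately show ?case
    by (intro exI[of _ "us @ vs"]) (subst foldr_mult_append; auto)
qed

lemma conj_eq_one_iff:
  assumes "h \<in> carrier G" "q \<in> carrier G"
  shows "h \<otimes> q \<otimes> inv h = \<one> \<longleftrightarrow> q = \<one>"
proof -
  have "h \<otimes> q \<otimes> inv h = h \<otimes> \<one> \<otimes> inv h \<longleftrightarrow> q = \<one>"
    using assms by (metis inv_closed l_cancel m_closed one_closed r_cancel)
  then show ?thesis using assms by simp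
qed

context
  fixes S assumes S: "finite_generating_set G S"
begin

lemma letters_closed: "S \<union> m_inv G ` S \<subseteq> carrier G"
  using S by (auto simp: finite_generating_set_def)

lemma word_length_witness:
  assumes "q \<in> carrier G"
  obtains ws where "length ws = word_length G S q" "set ws \<subseteq> S \<union> m_inv G ` S"
    "foldr (\<otimes>) ws \<one> = q"
proof -
  have "\<exists>ws. set ws \<subseteq> S \<union> m_inv G ` S \<and> foldr (\<otimes>) ws \<one> = q"
    using S assms by (intro generate_imp_word) (auto simp: finite_generating_set_def)
  then have "\<exists>m ws. length ws = m \<and> set ws \<subseteq> S \<union> m_inv G ` S \<and> foldr (\<otimes>) ws \<one> = q"
    by blast
  from LeastI_ex[OF this] show ?thesis
    using that unfolding word_length_def by blast
qed

lemma word_length_le: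
  assumes "set ws \<subseteq> S \<union> m_inv G ` S"
  shows "word_length G S (foldr (\<otimes>) ws \<one>) \<le> length ws"
  unfolding word_length_def using assms by (intro Least_le) blast

lemma word_length_one: "word_length G S \<one> = 0"
  using word_length_le[of "[]"] by simp

lemma wlen_eq_max: "q \<in> carrier G \<Longrightarrow> wlen G S q = max 1 (real (word_length G S q))"
proof -
  assume q: "q \<in> carrier G"
  obtain ws where "length ws = word_length G S q" "foldr (\<otimes>) ws \<one> = q"
    using q by (rule word_length_witness)
  then have "word_length G S q = 0 \<Longrightarrow> q = \<one>"
    by auto
  then show ?thesis
    by (cases "word_length G S q") (auto simp: wlen_def word_length_one)
qed

lemma wlen_ge_1: "q \<in> carrier G \<Longrightarrow> 1 \<le> wlen G S q"
  by (simp add: wlen_eq_max)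

lemma wlen_mult:
  assumes "x \<in> carrier G" "y \<in> carrier G"
  shows "wlen G S (x \<otimes> y) \<le> wlen G S x + wlen G S y"
proof -
  obtain us vs where
    us: "length us = word_length G S x" "set us \<subseteq> S \<union> m_inv G ` S" "foldr (\<otimes>) us \<one> = x" and
    vs: "length vs = word_length G S y" "set vs \<subseteq> S \<union> m_inv G ` S" "foldr (\<otimes>) vs \<one> = y"
    using assms by (metis word_length_witness)
  have "foldr (\<otimes>) (us @ vs) \<one> = x \<otimes> y"
    using us vs letters_closed by (subst foldr_mult_append) auto
  then have "word_length G S (x \<otimes> y) \<le> word_length G S x + word_length G S y"
    using word_length_le[of "us @ vs"] us vs by auto
  then show ?thesis using assms by (auto simp: wlen_eq_max)
qed

text \<open>Spelling an element with a shortest word bounds a subadditive function by its values on the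
  finitely many letters. This one estimate makes homomorphisms Lipschitz, makes all word lengths on
  a group equivalent, and bounds the norm of the coordinates in a free abelian group.\<close>

lemma subadditive_le_wlen:
  assumes "\<And>x y. x \<in> carrier G \<Longrightarrow> y \<in> carrier G \<Longrightarrow> f (x \<otimes> y) \<le> f x + f y"
  shows "\<exists>C>0. \<forall>x\<in>carrier G. f x \<le> C * wlen G S x"
proof -
  let ?L = "S \<union> m_inv G ` S"
  define M where "M = (\<Sum>s\<in>?L. \<bar>f s\<bar>)"
  have fin: "finite ?L" using S by (auto simp: finite_generating_set_def)
  have M: "f s \<le> M" if "s \<in> ?L" for s
    using member_le_sum[of s ?L "\<lambda>s. \<bar>f s\<bar>"] that fin unfolding M_def by force
  have M0: "M \<ge> 0" unfolding M_def by (intro sum_nonneg) auto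
  have word: "f (foldr (\<otimes>) ws \<one>) \<le> \<bar>f \<one>\<bar> + real (length ws) * M" if "set ws \<subseteq> ?L" for ws
    using that
  proof (induction ws)
    case (Cons s ws)
    then have "f (foldr (\<otimes>) (s # ws) \<one>) \<le> f s + f (foldr (\<otimes>) ws \<one>)"
      using letters_closed by (auto intro!: assms foldr_mult_closed)
    then show ?case using Cons M[of s] by (auto simp: algebra_simps)
  qed auto
  have "f x \<le> (1 + \<bar>f \<one>\<bar> + M) * wlen G S x" if x: "x \<in> carrier G" for x
  proof -
    obtain ws where ws: "length ws = word_length G S x" "set ws \<subseteq> ?L" "foldr (\<otimes>) ws \<one> = x"
      using x by (rule word_length_witness)
    have "f x \<le> \<bar>f \<one>\<bar> * 1 + M * real (word_length G S x)"
      using word[OF ws(2)] ws by (simp add: mult.commute)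
    also have "\<dots> \<le> \<bar>f \<one>\<bar> * wlen G S x + M * wlen G S x"
      using x M0 by (intro add_mono mult_left_mono) (auto simp: wlen_eq_max)
    also have "\<dots> \<le> (1 + \<bar>f \<one>\<bar> + M) * wlen G S x"
      using wlen_ge_1[OF x] by (simp add: algebra_simps)
    finally show ?thesis .
  qed
  then show ?thesis using M0 by (intro exI[of _ "1 + \<bar>f \<one>\<bar> + M"]) auto
qed

text \<open>The convention for the identity is compatible with minimising over a conjugacy class, because
  the identity is alone in its class.\<close>

lemma clen_le:
  assumes "h \<in> carrier G" "q \<in> carrier G"
  shows "clen G S q \<le> wlen G S (h \<otimes> q \<otimes> inv h)"
proof (cases "q = \<one>")
  case True
  then show ?thesis using assms by (simp add: clen_def wlen_def)
next
  case False
  have "conj_length G S q \<le> word_length G S (h \<otimes> q \<otimes> inv h)"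
    unfolding conj_length_def using assms(1) by (intro Least_le) blast
  then show ?thesis using False assms by (simp add: clen_def wlen_def conj_eq_one_iff)
qed

lemma clen_witness:
  assumes "q \<in> carrier G"
  obtains h where "h \<in> carrier G" "clen G S q = wlen G S (h \<otimes> q \<otimes> inv h)"
proof (cases "q = \<one>")
  case True
  then show ?thesis using that[of \<one>] by (simp add: clen_def wlen_def)
next
  case False
  have "\<exists>m. \<exists>h\<in>carrier G. m = word_length G S (h \<otimes> q \<otimes> inv h)"
    using one_closed by blast
  from LeastI_ex[OF this] obtain h where
    "h \<in> carrier G" "conj_length G S q = word_length G S (h \<otimes> q \<otimes> inv h)"
    unfolding conj_length_def by blast
  then show ?thesis
    using that[of h] False assms by (simp add: clen_def wlen_def conj_eq_one_iff)
qed

end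

end

lemma (in comm_group) clen_eq_wlen:
  assumes "finite_generating_set G S" "q \<in> carrier G"
  shows "clen G S q = wlen G S q"
proof -
  obtain h where h: "h \<in> carrier G" "clen G S q = wlen G S (h \<otimes> q \<otimes> inv h)"
    using assms by (rule clen_witness)
  have "h \<otimes> q \<otimes> inv h = q"
    using h assms(2) by (simp add: m_comm[of h q] m_assoc)
  then show ?thesis using h by simp
qed

lemma (in group_hom) hom_wlen_le:
  assumes "finite_generating_set G S" "finite_generating_set H T"
  shows "\<exists>C>0. \<forall>x\<in>carrier G. wlen H T (h x) \<le> C * wlen G S x"
  using assms by (intro G.subadditive_le_wlen) (simp_all add: H.wlen_mult)

lemma (in group_hom) hom_clen_le:
  assumes S: "finite_generating_set G S" and T: "finite_generating_set H T"
  shows "\<exists>C>0. \<forall>x\<in>carrier G. clen H T (h x) \<le> C * clen G S x"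
proof -
  obtain C where C: "C > 0" "\<And>x. x \<in> carrier G \<Longrightarrow> wlen H T (h x) \<le> C * wlen G S x"
    using hom_wlen_le[OF assms] by blast
  have "clen H T (h x) \<le> C * clen G S x" if x: "x \<in> carrier G" for x
  proof -
    obtain u where u: "u \<in> carrier G" "clen G S x = wlen G S (u \<otimes> x \<otimes> inv u)"
      using S x by (rule G.clen_witness)
    have "clen H T (h x) \<le> wlen H T (h u \<otimes>\<^bsub>H\<^esub> h x \<otimes>\<^bsub>H\<^esub> inv\<^bsub>H\<^esub> h u)"
      using T u x by (intro H.clen_le) auto
    also have "\<dots> = wlen H T (h (u \<otimes> x \<otimes> inv u))"
      using u x by simp
    also have "\<dots> \<le> C * clen G S x"
      using C(2)[of "u \<otimes> x \<otimes> inv u"] u x by simp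
    finally show ?thesis .
  qed
  then show ?thesis using C(1) by blast
qed

lemma (in group_hom) hom_wlen_growth:
  assumes "finite_generating_set G S" "finite_generating_set H T" "\<And>n::nat. x n \<in> carrier G"
  shows "(\<lambda>n. wlen H T (h (x n))) \<preceq> (\<lambda>n. wlen G S (x n))"
proof -
  obtain C where "C > 0" "\<And>y. y \<in> carrier G \<Longrightarrow> wlen H T (h y) \<le> C * wlen G S y"
    using hom_wlen_le[OF assms(1,2)] by blast
  then show ?thesis using assms(3) by (intro growth_leI[of C]) auto
qed

lemma (in group_hom) hom_clen_growth:
  assumes "finite_generating_set G S" "finite_generating_set H T" "\<And>n::nat. x n \<in> carrier G"
  shows "(\<lambda>n. clen H T (h (x n))) \<preceq> (\<lambda>n. clen G S (x n))"
proof -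
  obtain C where "C > 0" "\<And>y. y \<in> carrier G \<Longrightarrow> clen H T (h y) \<le> C * clen G S y"
    using hom_clen_le[OF assms(1,2)] by blast
  then show ?thesis using assms(3) by (intro growth_leI[of C]) auto
qed


section \<open>The free part of the abelianisation\<close>

lemma torsionI: "x \<in> carrier G \<Longrightarrow> (n::nat) > 0 \<Longrightarrow> x [^]\<^bsub>G\<^esub> n = \<one>\<^bsub>G\<^esub> \<Longrightarrow> x \<in> torsion G"
  by (auto simp: torsion_def)

lemma torsionE:
  assumes "x \<in> torsion G"
  obtains n :: nat where "x \<in> carrier G" "n > 0" "x [^]\<^bsub>G\<^esub> n = \<one>\<^bsub>G\<^esub>"
  using assms by (auto simp: torsion_def)

lemma (in group) torsion_eq_oneI:
  "(\<And>x. x \<in> torsion G \<Longrightarrow> x = \<one>) \<Longrightarrow> torsion G = {\<one>}"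
  by (auto intro: torsionI[of _ _ 1])

lemma (in comm_group) subgroup_torsion: "subgroup (torsion G) G"
proof
  fix x y assume "x \<in> torsion G" "y \<in> torsion G"
  then obtain m n :: nat where x: "x \<in> carrier G" "m > 0" "x [^] m = \<one>"
    and y: "y \<in> carrier G" "n > 0" "y [^] n = \<one>"
    by (meson torsionE)
  have "(x \<otimes> y) [^] (m * n) = x [^] (m * n) \<otimes> y [^] (n * m)"
    using x y by (simp add: pow_mult_distrib m_comm mult.commute)
  also have "\<dots> = (x [^] m) [^] n \<otimes> (y [^] n) [^] m"
    using x(1) y(1) by (simp only: nat_pow_pow)
  also have "\<dots> = \<one>"
    using x y by simp
  finally show "x \<otimes> y \<in> torsion G"
    using x y by (intro torsionI[of _ _ "m * n"]) auto
next
  fix x assume "x \<in> torsion G"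
  then show "inv x \<in> torsion G"
    by (elim torsionE) (auto simp: nat_pow_inv intro: torsionI)
next
  show "\<one> \<in> torsion G" by (intro torsionI[of _ _ 1]) auto
qed (auto simp: torsion_def)

lemma (in comm_group) torsion_free_quotient: "torsion (G Mod torsion G) = {\<one>\<^bsub>G Mod torsion G\<^esub>}"
proof -
  let ?Q = "G Mod torsion G"
  interpret T: normal "torsion G" G
    by (rule subgroup_imp_normal[OF subgroup_torsion])
  interpret Q: group ?Q
    by (rule T.factorgroup_is_group)
  have "U = \<one>\<^bsub>?Q\<^esub>" if "U \<in> torsion ?Q" for U
  proof -
    obtain n where U: "U \<in> carrier ?Q" "(n::nat) > 0" "U [^]\<^bsub>?Q\<^esub> n = \<one>\<^bsub>?Q\<^esub>"
      using \<open>U \<in> torsion ?Q\<close> by (rule torsionE)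
    then obtain x where x: "x \<in> carrier G" "U = torsion G #> x"
      by (auto simp: carrier_FactGroup)
    then have "torsion G #> (x [^] n) = torsion G"
      using U by (simp add: T.FactGroup_pow)
    then have "x [^] n \<in> torsion G"
      using x subgroup_torsion coset_join1[of "torsion G" "x [^] n"] by simp
    then obtain m where "(m::nat) > 0" "(x [^] n) [^] m = \<one>"
      by (rule torsionE)
    then have "x \<in> torsion G"
      using x U by (intro torsionI[of _ _ "n * m"]) (auto simp: nat_pow_pow)
    then show ?thesis
      using x subgroup_torsion by (simp add: coset_join2)
  qed
  then show ?thesis
    by (rule Q.torsion_eq_oneI)
qed

context group
begin

lemma comm_group_abelianisation: "comm_group (abelianisation G)"
  unfolding abelianisation_def by (rule derived_quot_is_comm_group)

lemma comm_group_free_ab: "comm_group (free_ab G)"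
  unfolding free_ab_def
  by (intro comm_group.abelian_FactGroup comm_group.subgroup_torsion comm_group_abelianisation)

lemma torsion_free_free_ab: "torsion (free_ab G) = {\<one>\<^bsub>free_ab G\<^esub>}"
  unfolding free_ab_def
  by (rule comm_group.torsion_free_quotient[OF comm_group_abelianisation])

lemma ab_elem_hom: "ab_elem G \<in> hom G (free_ab G)"
proof -
  let ?Ab = "abelianisation G"
  interpret Ab: comm_group ?Ab by (rule comm_group_abelianisation)
  have "(\<lambda>q. derived G (carrier G) #> q) \<in> hom G ?Ab"
    unfolding abelianisation_def by (rule normal.r_coset_hom_Mod[OF derived_self_is_normal])
  moreover have "(\<lambda>U. torsion ?Ab #>\<^bsub>?Ab\<^esub> U) \<in> hom ?Ab (free_ab G)"
    unfolding free_ab_def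
    by (rule normal.r_coset_hom_Mod[OF Ab.subgroup_imp_normal[OF Ab.subgroup_torsion]])
  ultimately have "(\<lambda>U. torsion ?Ab #>\<^bsub>?Ab\<^esub> U) \<circ> (\<lambda>q. derived G (carrier G) #> q) \<in> hom G (free_ab G)"
    by (rule Group.hom_compose)
  also have "(\<lambda>U. torsion ?Ab #>\<^bsub>?Ab\<^esub> U) \<circ> (\<lambda>q. derived G (carrier G) #> q) = ab_elem G"
    by (simp add: fun_eq_iff ab_elem_def)
  finally show ?thesis .
qed

text \<open>The universal property: a homomorphism to a torsion-free abelian group kills the derived
  subgroup, and then also the torsion of the abelianisation.\<close>

lemma free_ab_universal:
  assumes A: "comm_group A" "torsion A = {\<one>\<^bsub>A\<^esub>}" and f: "f \<in> hom G A"
  obtains r where "r \<in> hom (free_ab G) A" "\<And>g. g \<in> carrier G \<Longrightarrow> r (ab_elem G g) = f g"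
proof -
  let ?Ab = "abelianisation G" and ?D = "derived G (carrier G)"
  interpret A: comm_group A by fact
  interpret Ab: comm_group ?Ab by (rule comm_group_abelianisation)
  interpret f: group_hom G A f using f by unfold_locales
  have "f ` ?D = derived A (f ` carrier G)"
    using f.derived_img by blast
  also have "\<dots> = {\<one>\<^bsub>A\<^esub>}"
    by (rule A.derived_eq_singleton) auto
  finally have "?D \<subseteq> kernel G A f"
    using derived_in_carrier[of "carrier G"] by (auto simp: kernel_def)
  from f.FactGroup_universal_kernel[OF derived_self_is_normal this]
  obtain f' where f': "f' \<in> hom ?Ab A" "\<And>x. x \<in> carrier G \<Longrightarrow> f' (?D #> x) = f x"
    unfolding abelianisation_def by blast
  interpret f': group_hom ?Ab A f' using f' by unfold_locales
  have "torsion ?Ab \<subseteq> kernel ?Ab A f'"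
  proof
    fix x assume "x \<in> torsion ?Ab"
    then obtain n where x: "x \<in> carrier ?Ab" "(n::nat) > 0" "x [^]\<^bsub>?Ab\<^esub> n = \<one>\<^bsub>?Ab\<^esub>"
      by (rule torsionE)
    then have "f' x [^]\<^bsub>A\<^esub> n = \<one>\<^bsub>A\<^esub>"
      using f'.hom_nat_pow[of x n] by simp
    then have "f' x \<in> torsion A"
      using x by (intro torsionI[of _ _ n]) auto
    then show "x \<in> kernel ?Ab A f'"
      using x A(2) by (simp add: kernel_def)
  qed
  from f'.FactGroup_universal_kernel[OF Ab.subgroup_imp_normal[OF Ab.subgroup_torsion] this]
  obtain r where r: "r \<in> hom (free_ab G) A"
    "\<And>x. x \<in> carrier ?Ab \<Longrightarrow> r (torsion ?Ab #>\<^bsub>?Ab\<^esub> x) = f' x"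
    unfolding free_ab_def by blast
  have "r (ab_elem G g) = f g" if "g \<in> carrier G" for g
  proof -
    have "?D #> g \<in> carrier ?Ab"
      using that by (auto simp: abelianisation_def carrier_FactGroup)
    then show ?thesis
      using that by (simp add: ab_elem_def r(2) f'(2))
  qed
  with r(1) show ?thesis by (rule that)
qed

end

lemma free_abelian_comm_group:
  assumes "free_abelian A"
  shows "comm_group A"
proof -
  obtain B :: "'a set" and f where f: "group A" "f \<in> iso A (free_Abelian_group B)"
    using assms by (auto simp: free_abelian_def is_iso_def)
  then have "A \<cong> free_Abelian_group B" by (auto simp: is_iso_def)
  then show ?thesis
    using group.iso_sym[OF f(1)] comm_group.iso_imp_comm_group[OF abelian_free_Abelian_group]
      f(1) group.is_monoid by blast
qed

lemma free_abelian_torsion_free: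
  assumes "free_abelian A"
  shows "torsion A = {\<one>\<^bsub>A\<^esub>}"
proof -
  obtain B :: "'a set" and f where f: "group A" "f \<in> iso A (free_Abelian_group B)"
    using assms by (auto simp: free_abelian_def is_iso_def)
  interpret A: group A by fact
  interpret f: group_hom A "free_Abelian_group B" f
    using f by (intro group_hom.intro group_hom_axioms.intro) (auto simp: iso_def)
  have "x = \<one>\<^bsub>A\<^esub>" if "x \<in> torsion A" for x
  proof -
    obtain n where x: "x \<in> carrier A" "(n::nat) > 0" "x [^]\<^bsub>A\<^esub> n = \<one>\<^bsub>A\<^esub>"
      using \<open>x \<in> torsion A\<close> by (rule torsionE)
    then have "frag_cmul (int n) (f x) = 0"
      using f.hom_nat_pow[of x n] by simp
    then have "f x = f \<one>\<^bsub>A\<^esub>"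
      using x f.hom_one by (simp add: frag_cmul_eq_0_iff)
    then show ?thesis
      using f(2) x inj_onD[of f "carrier A" x "\<one>\<^bsub>A\<^esub>"] by (simp add: iso_iff)
  qed
  then show ?thesis
    by (rule A.torsion_eq_oneI)
qed


section \<open>Direct products\<close>

locale direct_product =
  fixes k :: nat and Gs :: "nat \<Rightarrow> 'a monoid" and A :: "'b monoid"
  assumes group_factor: "\<And>i. i \<in> {1..k} \<Longrightarrow> group (Gs i)"
    and comm_group_A: "comm_group A"
begin

abbreviation P :: "((nat \<Rightarrow> 'a) \<times> 'b) monoid" where
  "P \<equiv> product_with k Gs A"

definition incl_factor :: "nat \<Rightarrow> 'a \<Rightarrow> (nat \<Rightarrow> 'a) \<times> 'b" where
  "incl_factor i x = (\<lambda>j\<in>{1..k}. if j = i then x else \<one>\<^bsub>Gs j\<^esub>, \<one>\<^bsub>A\<^esub>)"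

definition incl_abelian :: "'b \<Rightarrow> (nat \<Rightarrow> 'a) \<times> 'b" where
  "incl_abelian a = (\<lambda>j\<in>{1..k}. \<one>\<^bsub>Gs j\<^esub>, a)"

sublocale A: comm_group A by (rule comm_group_A)

lemma group_P: "group P"
  unfolding product_with_def
  by (intro DirProd_group product_group group_factor) (auto intro: A.is_group)

sublocale P: group P by (rule group_P)

lemma carrier_P: "carrier P = (\<Pi>\<^sub>E i\<in>{1..k}. carrier (Gs i)) \<times> carrier A"
  by (simp add: product_with_def DirProd_def)

lemma mult_P: "g \<otimes>\<^bsub>P\<^esub> h = (\<lambda>i\<in>{1..k}. fst g i \<otimes>\<^bsub>Gs i\<^esub> fst h i, snd g \<otimes>\<^bsub>A\<^esub> snd h)"
  by (cases g; cases h) (simp add: product_with_def)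

lemma one_P: "\<one>\<^bsub>P\<^esub> = (\<lambda>i\<in>{1..k}. \<one>\<^bsub>Gs i\<^esub>, \<one>\<^bsub>A\<^esub>)"
  by (simp add: product_with_def)

lemma component_closed: "g \<in> carrier P \<Longrightarrow> i \<in> {1..k} \<Longrightarrow> fst g i \<in> carrier (Gs i)"
  by (auto simp: carrier_P)

lemma snd_closed: "g \<in> carrier P \<Longrightarrow> snd g \<in> carrier A"
  by (auto simp: carrier_P)

lemma P_eqI:
  assumes "g \<in> carrier P" "h \<in> carrier P" "\<And>i. i \<in> {1..k} \<Longrightarrow> fst g i = fst h i" "snd g = snd h"
  shows "g = h"
proof (rule prod_eqI)
  show "fst g = fst h"
  proof (rule PiE_ext)
    show "fst g \<in> (\<Pi>\<^sub>E i\<in>{1..k}. carrier (Gs i))" "fst h \<in> (\<Pi>\<^sub>E i\<in>{1..k}. carrier (Gs i))"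
      using assms(1,2) by (simp_all add: carrier_P mem_Times_iff)
  qed (rule assms(3))
qed (rule assms(4))

lemma group_hom_component:
  assumes "i \<in> {1..k}"
  shows "group_hom P (Gs i) (\<lambda>g. fst g i)"
  using assms
  by (intro group_hom.intro group_hom_axioms.intro group_P group_factor)
     (auto simp: hom_def mult_P carrier_P)

lemma snd_hom: "snd \<in> hom P A"
  by (auto simp: hom_def mult_P carrier_P)

lemma group_hom_incl_factor:
  assumes "i \<in> {1..k}"
  shows "group_hom (Gs i) P (incl_factor i)"
proof (intro group_hom.intro group_hom_axioms.intro group_P group_factor assms)
  have one: "\<one>\<^bsub>Gs j\<^esub> \<in> carrier (Gs j)" "\<one>\<^bsub>Gs j\<^esub> \<otimes>\<^bsub>Gs j\<^esub> \<one>\<^bsub>Gs j\<^esub> = \<one>\<^bsub>Gs j\<^esub>" if "j \<in> {1..k}" for j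
  proof -
    interpret group "Gs j" using that by (rule group_factor)
    show "\<one>\<^bsub>Gs j\<^esub> \<in> carrier (Gs j)" "\<one>\<^bsub>Gs j\<^esub> \<otimes>\<^bsub>Gs j\<^esub> \<one>\<^bsub>Gs j\<^esub> = \<one>\<^bsub>Gs j\<^esub>" by simp_all
  qed
  show "incl_factor i \<in> hom (Gs i) P"
    using one by (intro homI) (auto simp: incl_factor_def carrier_P mult_P intro!: restrict_ext)
qed

lemma incl_abelian_hom: "incl_abelian \<in> hom A P"
proof -
  have one: "\<one>\<^bsub>Gs j\<^esub> \<in> carrier (Gs j)" "\<one>\<^bsub>Gs j\<^esub> \<otimes>\<^bsub>Gs j\<^esub> \<one>\<^bsub>Gs j\<^esub> = \<one>\<^bsub>Gs j\<^esub>" if "j \<in> {1..k}" for j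
  proof -
    interpret group "Gs j" using that by (rule group_factor)
    show "\<one>\<^bsub>Gs j\<^esub> \<in> carrier (Gs j)" "\<one>\<^bsub>Gs j\<^esub> \<otimes>\<^bsub>Gs j\<^esub> \<one>\<^bsub>Gs j\<^esub> = \<one>\<^bsub>Gs j\<^esub>" by simp_all
  qed
  show ?thesis
    using one by (intro homI) (auto simp: incl_abelian_def carrier_P mult_P intro!: restrict_ext)
qed

lemma incl_factor_closed:
  "i \<in> {1..k} \<Longrightarrow> x \<in> carrier (Gs i) \<Longrightarrow> incl_factor i x \<in> carrier P"
  using group_hom.hom_closed[OF group_hom_incl_factor] .

lemma incl_abelian_closed: "a \<in> carrier A \<Longrightarrow> incl_abelian a \<in> carrier P"
  using incl_abelian_hom by (rule hom_in_carrier)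

text \<open>As the group need not be commutative, the product runs over an ordered list of factors.\<close>

lemma decomposition:
  assumes g: "g \<in> carrier P"
  shows "g = foldr (\<otimes>\<^bsub>P\<^esub>) (map (\<lambda>i. incl_factor i (fst g i)) [1..<Suc k]) (incl_abelian (snd g))"
proof -
  define t where "t j = (\<lambda>i\<in>{1..k}. if j \<le> i then fst g i else \<one>\<^bsub>Gs i\<^esub>, snd g)" for j
  \<comment> \<open>The product of the last factors, from the \<open>j\<close>-th on, is \<open>g\<close> with the coordinates below \<open>j\<close>
    erased.\<close>
  have "foldr (\<otimes>\<^bsub>P\<^esub>) (map (\<lambda>i. incl_factor i (fst g i)) [1..<Suc k]) (incl_abelian (snd g)) = t 1"
  proof (rule inc_induct[of 1 "Suc k"])
    show "foldr (\<otimes>\<^bsub>P\<^esub>) (map (\<lambda>i. incl_factor i (fst g i)) [Suc k..<Suc k]) (incl_abelian (snd g)) = t (Suc k)"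
      by (auto simp: t_def incl_abelian_def intro: restrict_ext)
  next
    fix n assume n: "1 \<le> n" "n < Suc k" and
      IH: "foldr (\<otimes>\<^bsub>P\<^esub>) (map (\<lambda>i. incl_factor i (fst g i)) [Suc n..<Suc k]) (incl_abelian (snd g)) = t (Suc n)"
    have "incl_factor n (fst g n) \<otimes>\<^bsub>P\<^esub> t (Suc n) = t n"
    proof -
      have "(if i = n then fst g n else \<one>\<^bsub>Gs i\<^esub>) \<otimes>\<^bsub>Gs i\<^esub> (if Suc n \<le> i then fst g i else \<one>\<^bsub>Gs i\<^esub>) =
            (if n \<le> i then fst g i else \<one>\<^bsub>Gs i\<^esub>)" if "i \<in> {1..k}" for i
      proof -
        interpret group "Gs i" using that by (rule group_factor)
        show ?thesis
        proof (cases "n = i")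
          case True
          then show ?thesis using component_closed[OF g that] by simp
        next
          case False
          then show ?thesis using component_closed[OF g that] by (cases "n < i") auto
        qed
      qed
      moreover have "snd g \<in> carrier A" using g by (auto simp: carrier_P)
      ultimately show ?thesis
        by (auto simp: mult_P incl_factor_def t_def intro!: restrict_ext)
    qed
    then show "foldr (\<otimes>\<^bsub>P\<^esub>) (map (\<lambda>i. incl_factor i (fst g i)) [n..<Suc k]) (incl_abelian (snd g)) = t n"
      using n IH by (simp add: upt_conv_Cons del: upt_Suc)
  qed simp
  also have "t 1 = g"
    using g by (auto simp: t_def carrier_P prod_eq_iff PiE_iff extensional_def)
  finally show ?thesis by simp
qed

lemma partial_product_closed:
  assumes "g \<in> carrier P" "set is \<subseteq> {1..k}"
  shows "foldr (\<otimes>\<^bsub>P\<^esub>) (map (\<lambda>i. incl_factor i (fst g i)) is) (incl_abelian (snd g)) \<in> carrier P"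
  using assms(2)
proof (induction "is")
  case Nil
  then show ?case using assms(1) by (simp add: snd_closed incl_abelian_closed)
next
  case (Cons i "is")
  then show ?case using component_closed[OF assms(1)] by (simp add: incl_factor_closed)
qed

lemma hom_eq_on_factorsI:
  assumes "f \<in> hom P H" "f' \<in> hom P H"
    and "\<And>i x. i \<in> {1..k} \<Longrightarrow> x \<in> carrier (Gs i) \<Longrightarrow> f (incl_factor i x) = f' (incl_factor i x)"
    and "\<And>a. a \<in> carrier A \<Longrightarrow> f (incl_abelian a) = f' (incl_abelian a)"
    and g: "g \<in> carrier P"
  shows "f g = f' g"
proof -
  have "f (foldr (\<otimes>\<^bsub>P\<^esub>) (map (\<lambda>i. incl_factor i (fst g i)) is) (incl_abelian (snd g))) =
        f' (foldr (\<otimes>\<^bsub>P\<^esub>) (map (\<lambda>i. incl_factor i (fst g i)) is) (incl_abelian (snd g)))"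
    if "set is \<subseteq> {1..k}" for "is"
    using that
  proof (induction "is")
    case Nil
    then show ?case using assms(4) g by (auto simp: carrier_P)
  next
    case (Cons i "is")
    let ?z = "foldr (\<otimes>\<^bsub>P\<^esub>) (map (\<lambda>i. incl_factor i (fst g i)) is) (incl_abelian (snd g))"
    have i: "i \<in> {1..k}" and x: "fst g i \<in> carrier (Gs i)"
      using Cons.prems component_closed[OF g] by auto
    have "?z \<in> carrier P"
      using Cons.prems by (intro partial_product_closed[OF g]) auto
    then show ?case
      using Cons i x incl_factor_closed[OF i x] assms(3)[OF i x]
        hom_mult[OF assms(1)] hom_mult[OF assms(2)] by simp
  qed
  from this[of "[1..<Suc k]"] have *: "set [1..<Suc k] \<subseteq> {1..k} \<Longrightarrow> ?thesis"
    unfolding decomposition[OF g, symmetric] .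
  show ?thesis by (rule *) auto
qed

subsection \<open>Lengths in a direct product\<close>

lemma wlen_le_sum:
  assumes S: "finite_generating_set P S" and g: "g \<in> carrier P"
  shows "wlen P S g \<le> (\<Sum>i=1..k. wlen P S (incl_factor i (fst g i))) + wlen P S (incl_abelian (snd g))"
proof -
  have a: "snd g \<in> carrier A" using g by (auto simp: carrier_P)
  have "wlen P S (foldr (\<otimes>\<^bsub>P\<^esub>) (map (\<lambda>i. incl_factor i (fst g i)) is) (incl_abelian (snd g))) \<le>
      sum_list (map (\<lambda>i. wlen P S (incl_factor i (fst g i))) is) + wlen P S (incl_abelian (snd g))"
    if "set is \<subseteq> {1..k}" for "is"
    using that
  proof (induction "is")
    case (Cons i "is")
    let ?z = "foldr (\<otimes>\<^bsub>P\<^esub>) (map (\<lambda>i. incl_factor i (fst g i)) is) (incl_abelian (snd g))"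
    have "incl_factor i (fst g i) \<in> carrier P" "?z \<in> carrier P"
      using Cons.prems component_closed[OF g]
      by (auto intro!: partial_product_closed[OF g] incl_factor_closed)
    then have "wlen P S (incl_factor i (fst g i) \<otimes>\<^bsub>P\<^esub> ?z) \<le> wlen P S (incl_factor i (fst g i)) + wlen P S ?z"
      using S by (intro P.wlen_mult)
    then show ?case using Cons by simp
  qed simp
  from this[of "[1..<Suc k]"] show ?thesis
    unfolding decomposition[OF g, symmetric]
    by (simp add: sum_list_distinct_conv_sum_set atLeastLessThanSuc_atLeastAtMost del: upt_Suc)
qed

context
  fixes S and Ss :: "nat \<Rightarrow> 'a set" and T
  assumes S: "finite_generating_set P S"
    and Ss: "\<And>i. i \<in> {1..k} \<Longrightarrow> finite_generating_set (Gs i) (Ss i)"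
    and T: "finite_generating_set (free_ab P) T"
begin

lemma group_hom_ab_elem: "group_hom P (free_ab P) (ab_elem P)"
  using P.comm_group_free_ab P.ab_elem_hom
  by (intro group_hom.intro group_hom_axioms.intro group_P) (auto simp: comm_group_def)

text \<open>One direction holds because the coordinates and the passage to the free part of the
  abelianisation are homomorphisms.\<close>

lemma wlen_growth_components_le:
  assumes x: "\<And>n::nat. x n \<in> carrier P"
  shows "(\<lambda>n. (\<Sum>i=1..k. wlen (Gs i) (Ss i) (fst (x n) i)) + wlen (free_ab P) T (ab_elem P (x n)))
    \<preceq> (\<lambda>n. wlen P S (x n))"
proof (intro growth_le_add growth_le_sum)
  show "0 \<le> wlen P S (x n)" for n
    using P.wlen_ge_1[OF S x, of n] by simp
  show "(\<lambda>n. wlen (Gs i) (Ss i) (fst (x n) i)) \<preceq> (\<lambda>n. wlen P S (x n))" if "i \<in> {1..k}" for i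
    using group_hom.hom_wlen_growth[OF group_hom_component[OF that] S Ss[OF that]] x .
  show "(\<lambda>n. wlen (free_ab P) T (ab_elem P (x n))) \<preceq> (\<lambda>n. wlen P S (x n))"
    using group_hom.hom_wlen_growth[OF group_hom_ab_elem S T] x .
qed

lemma clen_growth_components_le:
  assumes x: "\<And>n::nat. x n \<in> carrier P"
  shows "(\<lambda>n. (\<Sum>i=1..k. clen (Gs i) (Ss i) (fst (x n) i)) + wlen (free_ab P) T (ab_elem P (x n)))
    \<preceq> (\<lambda>n. clen P S (x n))"
proof (intro growth_le_add growth_le_sum)
  show "0 \<le> clen P S (x n)" for n
    by (simp add: clen_def)
  show "(\<lambda>n. clen (Gs i) (Ss i) (fst (x n) i)) \<preceq> (\<lambda>n. clen P S (x n))" if "i \<in> {1..k}" for i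
    using group_hom.hom_clen_growth[OF group_hom_component[OF that] S Ss[OF that]] x .
  have "ab_elem P (x n) \<in> carrier (free_ab P)" for n
    using P.ab_elem_hom x by (rule hom_in_carrier)
  then have "clen (free_ab P) T (ab_elem P (x n)) = wlen (free_ab P) T (ab_elem P (x n))" for n
    using comm_group.clen_eq_wlen[OF P.comm_group_free_ab T] by blast
  with group_hom.hom_clen_growth[OF group_hom_ab_elem S T x]
  show "(\<lambda>n. wlen (free_ab P) T (ab_elem P (x n))) \<preceq> (\<lambda>n. clen P S (x n))"
    by simp
qed

context
  assumes torsion_free: "torsion A = {\<one>\<^bsub>A\<^esub>}"
begin

text \<open>For the converse direction the abelian factor has to be recovered from the abelianisation. The
  projection to it factors through \<^term>\<open>free_ab P\<close>, because its values lie in a torsion-free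
  abelian group; following this by the inclusion gives a homomorphism back to the product.\<close>

lemma wlen_growth_le_components:
  assumes x: "\<And>n::nat. x n \<in> carrier P"
  shows "(\<lambda>n. wlen P S (x n)) \<preceq>
    (\<lambda>n. (\<Sum>i=1..k. wlen (Gs i) (Ss i) (fst (x n) i)) + wlen (free_ab P) T (ab_elem P (x n)))"
    (is "_ \<preceq> ?b")
proof -
  have F: "wlen (Gs i) (Ss i) (fst (x n) i) \<ge> 0" if "i \<in> {1..k}" for i n
    using group.wlen_ge_1[OF group_factor[OF that] Ss[OF that] component_closed[OF x that], of n]
    by simp
  have ab: "ab_elem P (x n) \<in> carrier (free_ab P)" for n
    using P.ab_elem_hom x by (rule hom_in_carrier)
  have "wlen (free_ab P) T (ab_elem P (x n)) \<ge> 0" for n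
    using group.wlen_ge_1[OF _ T ab, of n] P.comm_group_free_ab by (simp add: comm_group_def)
  note nonneg = F this
  have b: "?b n \<ge> 0" for n
    using nonneg by (intro add_nonneg_nonneg sum_nonneg) auto
  obtain r where r: "r \<in> hom (free_ab P) A" "\<And>g. g \<in> carrier P \<Longrightarrow> r (ab_elem P g) = snd g"
    using P.free_ab_universal[OF comm_group_A torsion_free snd_hom] by blast
  have "incl_abelian \<circ> r \<in> hom (free_ab P) P"
    using r(1) incl_abelian_hom by (rule Group.hom_compose)
  then interpret r: group_hom "free_ab P" P "incl_abelian \<circ> r"
    using P.comm_group_free_ab
    by (intro group_hom.intro group_hom_axioms.intro group_P) (auto simp: comm_group_def)
  have "(\<lambda>n. (\<Sum>i=1..k. wlen P S (incl_factor i (fst (x n) i))) + wlen P S (incl_abelian (snd (x n)))) \<preceq> ?b"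
  proof (intro growth_le_add growth_le_sum)
    show "(\<lambda>n. wlen P S (incl_factor i (fst (x n) i))) \<preceq> ?b" if i: "i \<in> {1..k}" for i
    proof (rule growth_le_trans)
      show "(\<lambda>n. wlen P S (incl_factor i (fst (x n) i))) \<preceq> (\<lambda>n. wlen (Gs i) (Ss i) (fst (x n) i))"
        using group_hom.hom_wlen_growth[OF group_hom_incl_factor[OF i] Ss[OF i] S] component_closed[OF x i] .
      show "(\<lambda>n. wlen (Gs i) (Ss i) (fst (x n) i)) \<preceq> ?b"
        using i nonneg by (intro growth_le_mono add_increasing2 member_le_sum) auto
    qed
    have "(\<lambda>n. wlen P S (incl_abelian (snd (x n)))) \<preceq> (\<lambda>n. wlen (free_ab P) T (ab_elem P (x n)))"
      using r.hom_wlen_growth[OF T S, of "\<lambda>n. ab_elem P (x n)"] ab r(2) x by simp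
    also have "\<dots> \<preceq> ?b"
      using nonneg by (intro growth_le_mono add_increasing sum_nonneg) auto
    finally show "(\<lambda>n. wlen P S (incl_abelian (snd (x n)))) \<preceq> ?b" .
  qed (rule b)
  moreover have "(\<lambda>n. wlen P S (x n)) \<preceq>
      (\<lambda>n. (\<Sum>i=1..k. wlen P S (incl_factor i (fst (x n) i))) + wlen P S (incl_abelian (snd (x n))))"
    using wlen_le_sum[OF S x] by (rule growth_le_mono)
  ultimately show ?thesis by (rule growth_le_trans[rotated])
qed

text \<open>The coordinates can be conjugated to minimal length independently of each other, and the image
  in an abelian group does not notice.\<close>

lemma clen_growth_le_components:
  assumes x: "\<And>n::nat. x n \<in> carrier P"
  shows "(\<lambda>n. clen P S (x n)) \<preceq>
    (\<lambda>n. (\<Sum>i=1..k. clen (Gs i) (Ss i) (fst (x n) i)) + wlen (free_ab P) T (ab_elem P (x n)))"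
proof -
  interpret ab: group_hom P "free_ab P" "ab_elem P" by (rule group_hom_ab_elem)
  interpret F: comm_group "free_ab P" by (rule P.comm_group_free_ab)
  have "\<exists>h. h \<in> carrier P \<and> (\<forall>i\<in>{1..k}. clen (Gs i) (Ss i) (fst (x n) i) =
      wlen (Gs i) (Ss i) (fst (h \<otimes>\<^bsub>P\<^esub> x n \<otimes>\<^bsub>P\<^esub> inv\<^bsub>P\<^esub> h) i))" for n
  proof -
    have "\<forall>i\<in>{1..k}. \<exists>u. u \<in> carrier (Gs i) \<and> clen (Gs i) (Ss i) (fst (x n) i) =
        wlen (Gs i) (Ss i) (u \<otimes>\<^bsub>Gs i\<^esub> fst (x n) i \<otimes>\<^bsub>Gs i\<^esub> inv\<^bsub>Gs i\<^esub> u)"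
    proof
      fix i assume i: "i \<in> {1..k}"
      show "\<exists>u. u \<in> carrier (Gs i) \<and> clen (Gs i) (Ss i) (fst (x n) i) =
        wlen (Gs i) (Ss i) (u \<otimes>\<^bsub>Gs i\<^esub> fst (x n) i \<otimes>\<^bsub>Gs i\<^esub> inv\<^bsub>Gs i\<^esub> u)"
        by (rule group.clen_witness[OF group_factor[OF i] Ss[OF i] component_closed[OF x i]]) blast
    qed
    from bchoice[OF this] obtain u where u: "\<forall>i\<in>{1..k}. u i \<in> carrier (Gs i) \<and>
        clen (Gs i) (Ss i) (fst (x n) i) =
        wlen (Gs i) (Ss i) (u i \<otimes>\<^bsub>Gs i\<^esub> fst (x n) i \<otimes>\<^bsub>Gs i\<^esub> inv\<^bsub>Gs i\<^esub> u i)"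
      by blast
    define h where "h = (restrict u {1..k}, \<one>\<^bsub>A\<^esub>)"
    have h: "h \<in> carrier P" using u by (auto simp: h_def carrier_P)
    have "fst (h \<otimes>\<^bsub>P\<^esub> x n \<otimes>\<^bsub>P\<^esub> inv\<^bsub>P\<^esub> h) i = u i \<otimes>\<^bsub>Gs i\<^esub> fst (x n) i \<otimes>\<^bsub>Gs i\<^esub> inv\<^bsub>Gs i\<^esub> u i"
      if i: "i \<in> {1..k}" for i
    proof -
      interpret pr: group_hom P "Gs i" "\<lambda>g. fst g i" using i by (rule group_hom_component)
      show ?thesis using h x[of n] i by (simp add: pr.hom_mult pr.hom_inv) (simp add: h_def)
    qed
    then show ?thesis using h u by (intro exI[of _ h]) auto
  qed
  then obtain h where h': "\<forall>n. h n \<in> carrier P \<and> (\<forall>i\<in>{1..k}. clen (Gs i) (Ss i) (fst (x n) i) =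
      wlen (Gs i) (Ss i) (fst (h n \<otimes>\<^bsub>P\<^esub> x n \<otimes>\<^bsub>P\<^esub> inv\<^bsub>P\<^esub> h n) i))"
    using choice[of "\<lambda>n h. h \<in> carrier P \<and> (\<forall>i\<in>{1..k}. clen (Gs i) (Ss i) (fst (x n) i) =
      wlen (Gs i) (Ss i) (fst (h \<otimes>\<^bsub>P\<^esub> x n \<otimes>\<^bsub>P\<^esub> inv\<^bsub>P\<^esub> h) i))"] by (auto simp del: atLeastAtMost_iff)
  then have h: "h n \<in> carrier P" and
    hx: "i \<in> {1..k} \<Longrightarrow> clen (Gs i) (Ss i) (fst (x n) i) =
      wlen (Gs i) (Ss i) (fst (h n \<otimes>\<^bsub>P\<^esub> x n \<otimes>\<^bsub>P\<^esub> inv\<^bsub>P\<^esub> h n) i)" for n i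
    by simp_all
  define y where "y n = h n \<otimes>\<^bsub>P\<^esub> x n \<otimes>\<^bsub>P\<^esub> inv\<^bsub>P\<^esub> h n" for n
  have y: "y n \<in> carrier P" for n using h x by (simp add: y_def)
  have ab: "ab_elem P (y n) = ab_elem P (x n)" for n
  proof -
    have "ab_elem P (y n) = ab_elem P (h n) \<otimes>\<^bsub>free_ab P\<^esub> ab_elem P (x n) \<otimes>\<^bsub>free_ab P\<^esub> inv\<^bsub>free_ab P\<^esub> ab_elem P (h n)"
      using h[of n] x[of n] by (simp add: y_def)
    also have "\<dots> = ab_elem P (x n) \<otimes>\<^bsub>free_ab P\<^esub> ab_elem P (h n) \<otimes>\<^bsub>free_ab P\<^esub> inv\<^bsub>free_ab P\<^esub> ab_elem P (h n)"
      using h[of n] x[of n] by (subst F.m_comm) auto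
    also have "\<dots> = ab_elem P (x n)"
      using h[of n] x[of n] by (simp add: ab.H.m_assoc)
    finally show ?thesis .
  qed
  have "(\<lambda>n. clen P S (x n)) \<preceq> (\<lambda>n. wlen P S (y n))"
    unfolding y_def using h x S by (intro growth_le_mono P.clen_le)
  also have "(\<lambda>n. wlen P S (y n)) \<preceq>
    (\<lambda>n. (\<Sum>i=1..k. wlen (Gs i) (Ss i) (fst (y n) i)) + wlen (free_ab P) T (ab_elem P (y n)))"
    by (rule wlen_growth_le_components[OF y])
  also have "\<dots> = (\<lambda>n. (\<Sum>i=1..k. clen (Gs i) (Ss i) (fst (x n) i)) + wlen (free_ab P) T (ab_elem P (x n)))"
    by (simp add: ab hx flip: y_def)
  finally show ?thesis .
qed

end

end

end

subsection \<open>Automorphisms of a direct product\<close>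

context direct_product
begin

lemma group_hom_Aut0: "\<phi> \<in> Aut0 k Gs A \<Longrightarrow> group_hom P P \<phi>"
  by (intro group_hom.intro group_hom_axioms.intro group_P) (auto simp: Aut0_def auto_def)

lemma generate_factor_abelian:
  assumes i: "i \<in> {1..k}"
    and g: "g \<in> generate P (factor k Gs A i \<union> abelian_factor k Gs A)"
  shows "g \<in> carrier P \<and> (\<forall>j\<in>{1..k} - {i}. fst g j = \<one>\<^bsub>Gs j\<^esub>)"
proof -
  let ?N = "{g \<in> carrier P. \<forall>j\<in>{1..k} - {i}. fst g j = \<one>\<^bsub>Gs j\<^esub>}"
  have gens: "factor k Gs A i \<union> abelian_factor k Gs A \<subseteq> ?N"
  proof -
    have "factor k Gs A i \<subseteq> ?N"
      using incl_factor_closed[OF i] by (auto simp: factor_def incl_factor_def split: if_splits)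
    moreover have "abelian_factor k Gs A \<subseteq> ?N"
      using incl_abelian_closed by (auto simp: abelian_factor_def incl_abelian_def)
    ultimately show ?thesis by blast
  qed
  have "subgroup ?N P"
  proof (rule P.subgroupI)
    fix g h assume gh: "g \<in> ?N" "h \<in> ?N"
    have "fst (inv\<^bsub>P\<^esub> g) j = \<one>\<^bsub>Gs j\<^esub>" "fst (g \<otimes>\<^bsub>P\<^esub> h) j = \<one>\<^bsub>Gs j\<^esub>" if j: "j \<in> {1..k} - {i}" for j
    proof -
      interpret pr: group_hom P "Gs j" "\<lambda>g. fst g j" using j by (intro group_hom_component) auto
      show "fst (inv\<^bsub>P\<^esub> g) j = \<one>\<^bsub>Gs j\<^esub>" "fst (g \<otimes>\<^bsub>P\<^esub> h) j = \<one>\<^bsub>Gs j\<^esub>"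
        using gh j by (simp_all add: pr.hom_inv pr.hom_mult)
    qed
    then show "inv\<^bsub>P\<^esub> g \<in> ?N" "g \<otimes>\<^bsub>P\<^esub> h \<in> ?N"
      using gh by auto
  next
    have "\<one>\<^bsub>P\<^esub> \<in> ?N" by (simp add: one_P[symmetric]) (simp add: one_P)
    then show "?N \<noteq> {}" by blast
  qed auto
  then show ?thesis
    using P.generate_subgroup_incl[OF gens] g by blast
qed

text \<open>Commuting with the embedded \<open>i\<close>-th factor makes the \<open>i\<close>-th coordinate central there.\<close>

lemma center_component:
  assumes z: "z \<in> carrier P" and comm: "\<And>g. g \<in> carrier P \<Longrightarrow> z \<otimes>\<^bsub>P\<^esub> g = g \<otimes>\<^bsub>P\<^esub> z"
    and i: "i \<in> {1..k}" and trivial: "center (Gs i) = {\<one>\<^bsub>Gs i\<^esub>}"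
  shows "fst z i = \<one>\<^bsub>Gs i\<^esub>"
proof -
  have "fst z i \<in> center (Gs i)"
    unfolding center_def
  proof (safe intro!: component_closed[OF z i])
    fix x assume x: "x \<in> carrier (Gs i)"
    have "fst (z \<otimes>\<^bsub>P\<^esub> incl_factor i x) i = fst (incl_factor i x \<otimes>\<^bsub>P\<^esub> z) i"
      using comm incl_factor_closed[OF i x] by simp
    then show "fst z i \<otimes>\<^bsub>Gs i\<^esub> x = x \<otimes>\<^bsub>Gs i\<^esub> fst z i"
      using i by (simp add: mult_P incl_factor_def)
  qed
  then show ?thesis using trivial by simp
qed

lemma incl_abelian_central:
  assumes a: "a \<in> carrier A" and g: "g \<in> carrier P"
  shows "incl_abelian a \<otimes>\<^bsub>P\<^esub> g = g \<otimes>\<^bsub>P\<^esub> incl_abelian a"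
proof -
  have "\<one>\<^bsub>Gs i\<^esub> \<otimes>\<^bsub>Gs i\<^esub> fst g i = fst g i \<otimes>\<^bsub>Gs i\<^esub> \<one>\<^bsub>Gs i\<^esub>" if i: "i \<in> {1..k}" for i
  proof -
    interpret group "Gs i" using i by (rule group_factor)
    show ?thesis using component_closed[OF g i] by simp
  qed
  moreover have "a \<otimes>\<^bsub>A\<^esub> snd g = snd g \<otimes>\<^bsub>A\<^esub> a"
    using a snd_closed[OF g] by (rule A.m_comm)
  ultimately show ?thesis
    by (auto simp: mult_P incl_abelian_def intro!: restrict_ext)
qed

definition component_aut :: "((nat \<Rightarrow> 'a) \<times> 'b \<Rightarrow> (nat \<Rightarrow> 'a) \<times> 'b) \<Rightarrow> nat \<Rightarrow> 'a \<Rightarrow> 'a" where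
  "component_aut \<phi> i = (\<lambda>x\<in>carrier (Gs i). fst (\<phi> (incl_factor i x)) i)"

context
  fixes \<phi>
  assumes \<phi>: "\<phi> \<in> Aut0 k Gs A"
    and centreless: "\<And>i. i \<in> {1..k} \<Longrightarrow> center (Gs i) = {\<one>\<^bsub>Gs i\<^esub>}"
begin

interpretation \<phi>: group_hom P P \<phi>
  using \<phi> by (rule group_hom_Aut0)

lemma Aut0_inj: "inj_on \<phi> (carrier P)" and Aut0_surj: "\<phi> ` carrier P = carrier P"
  using \<phi> by (auto simp: Aut0_def auto_def Bij_def bij_betw_def)

lemma Aut0_incl_factor:
  assumes i: "i \<in> {1..k}" and x: "x \<in> carrier (Gs i)" and j: "j \<in> {1..k}" "j \<noteq> i"
  shows "fst (\<phi> (incl_factor i x)) j = \<one>\<^bsub>Gs j\<^esub>"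
proof -
  let ?N = "generate P (factor k Gs A i \<union> abelian_factor k Gs A)"
  have "incl_factor i x \<in> ?N"
    using x by (intro generate.incl) (auto simp: factor_def incl_factor_def)
  moreover have "\<phi> ` ?N = ?N"
    using \<phi> i by (auto simp: Aut0_def)
  ultimately have "\<phi> (incl_factor i x) \<in> ?N" by blast
  then show ?thesis using generate_factor_abelian[OF i] j by blast
qed

text \<open>An automorphism preserves the centre, and the centre of the product has trivial coordinates in
  the centreless factors.\<close>

lemma Aut0_incl_abelian:
  assumes a: "a \<in> carrier A" and i: "i \<in> {1..k}"
  shows "fst (\<phi> (incl_abelian a)) i = \<one>\<^bsub>Gs i\<^esub>"
proof (rule center_component)
  show "\<phi> (incl_abelian a) \<in> carrier P"
    using a by (simp add: incl_abelian_closed)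
  fix g assume "g \<in> carrier P"
  then have "g \<in> \<phi> ` carrier P"
    using Aut0_surj by simp
  then obtain h where h: "h \<in> carrier P" "g = \<phi> h"
    by blast
  show "\<phi> (incl_abelian a) \<otimes>\<^bsub>P\<^esub> g = g \<otimes>\<^bsub>P\<^esub> \<phi> (incl_abelian a)"
    unfolding h(2) using incl_abelian_central[OF a h(1)] h(1) incl_abelian_closed[OF a]
    by (simp flip: \<phi>.hom_mult)
qed (use i centreless in auto)

lemma component_aut_hom:
  assumes i: "i \<in> {1..k}"
  shows "component_aut \<phi> i \<in> hom (Gs i) (Gs i)"
proof -
  interpret incl: group_hom "Gs i" P "incl_factor i" using i by (rule group_hom_incl_factor)
  interpret pr: group_hom P "Gs i" "\<lambda>g. fst g i" using i by (rule group_hom_component)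
  show ?thesis
    by (rule homI) (auto simp: component_aut_def)
qed

text \<open>Both sides are homomorphisms in the group element, so that it suffices to compare them on the
  factors: the other factors map to elements with trivial coordinate because \<^term>\<open>\<phi>\<close>
  preserves the subgroups in the definition of \<^const>\<open>Aut0\<close>, the abelian factor because it
  is central.\<close>

lemma Aut0_component:
  assumes i: "i \<in> {1..k}" and g: "g \<in> carrier P"
  shows "fst (\<phi> g) i = component_aut \<phi> i (fst g i)"
proof -
  interpret pr: group_hom P "Gs i" "\<lambda>g. fst g i" using i by (rule group_hom_component)
  interpret c: group_hom "Gs i" "Gs i" "component_aut \<phi> i"
    using component_aut_hom[OF i] by unfold_locales
  show ?thesis
  proof (rule hom_eq_on_factorsI[where H = "Gs i" and g = g])
    show "(\<lambda>g. fst (\<phi> g) i) \<in> hom P (Gs i)" "(\<lambda>g. component_aut \<phi> i (fst g i)) \<in> hom P (Gs i)"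
      by (auto simp: hom_def)
  next
    fix j x assume j: "j \<in> {1..k}" "x \<in> carrier (Gs j)"
    show "fst (\<phi> (incl_factor j x)) i = component_aut \<phi> i (fst (incl_factor j x) i)"
    proof (cases "j = i")
      case True
      then show ?thesis using j by (simp add: component_aut_def) (simp add: incl_factor_def)
    next
      case False
      then have "fst (incl_factor j x) i = \<one>\<^bsub>Gs i\<^esub>" using i by (simp add: incl_factor_def)
      then show ?thesis using Aut0_incl_factor[OF j i] False by simp
    qed
  next
    fix a assume a: "a \<in> carrier A"
    have "fst (incl_abelian a) i = \<one>\<^bsub>Gs i\<^esub>" using i by (simp add: incl_abelian_def)
    then show "fst (\<phi> (incl_abelian a)) i = component_aut \<phi> i (fst (incl_abelian a) i)"
      using Aut0_incl_abelian[OF a i] by simp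
  qed (rule g)
qed

text \<open>For injectivity: if the coordinate of the image of \<open>x\<close> is trivial, then the image lies in the
  abelian factor and is central, hence so is \<open>x\<close>.\<close>

lemma component_aut_auto:
  assumes i: "i \<in> {1..k}"
  shows "component_aut \<phi> i \<in> auto (Gs i)"
proof -
  interpret incl: group_hom "Gs i" P "incl_factor i" using i by (rule group_hom_incl_factor)
  interpret c: group_hom "Gs i" "Gs i" "component_aut \<phi> i"
    using component_aut_hom[OF i] by unfold_locales
  have fst_incl: "fst (incl_factor i x) i = x" for x
    using i by (simp add: incl_factor_def)
  have "inj_on (component_aut \<phi> i) (carrier (Gs i))"
  proof (rule c.inj_on_one_iff[THEN iffD2], intro allI impI)
    fix x assume x: "x \<in> carrier (Gs i)" and 1: "component_aut \<phi> i x = \<one>\<^bsub>Gs i\<^esub>"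
    let ?z = "incl_factor i x"
    have z: "?z \<in> carrier P" using x by simp
    have comp: "fst (\<phi> ?z) j = \<one>\<^bsub>Gs j\<^esub>" if "j \<in> {1..k}" for j
      using Aut0_incl_factor[OF i x that] 1 x by (cases "j = i") (auto simp: component_aut_def)
    have a: "snd (\<phi> ?z) \<in> carrier A" using z by (simp add: snd_closed)
    obtain b where b: "b \<in> carrier A" "\<phi> ?z = incl_abelian b"
    proof
      show "\<phi> ?z = incl_abelian (snd (\<phi> ?z))"
      proof (rule P_eqI)
        show "fst (\<phi> ?z) j = fst (incl_abelian (snd (\<phi> ?z))) j" if "j \<in> {1..k}" for j
          using comp[OF that] that by (simp add: incl_abelian_def)
      qed (use z a in \<open>simp_all add: incl_abelian_closed\<close>, simp add: incl_abelian_def)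
    qed (rule a)
    have "?z \<otimes>\<^bsub>P\<^esub> g = g \<otimes>\<^bsub>P\<^esub> ?z" if g: "g \<in> carrier P" for g
    proof (rule inj_onD[OF Aut0_inj])
      show "\<phi> (?z \<otimes>\<^bsub>P\<^esub> g) = \<phi> (g \<otimes>\<^bsub>P\<^esub> ?z)"
        using incl_abelian_central[OF b(1), of "\<phi> g"] g z by (simp add: b(2))
    qed (use g z in simp_all)
    from center_component[OF z this i centreless[OF i]]
    show "x = \<one>\<^bsub>Gs i\<^esub>" by (simp add: fst_incl)
  qed
  moreover have "component_aut \<phi> i ` carrier (Gs i) = carrier (Gs i)"
  proof
    show "carrier (Gs i) \<subseteq> component_aut \<phi> i ` carrier (Gs i)"
    proof
      fix y assume y: "y \<in> carrier (Gs i)"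
      then have "incl_factor i y \<in> \<phi> ` carrier P"
        using Aut0_surj by simp
      then obtain g where g: "g \<in> carrier P" "incl_factor i y = \<phi> g"
        by blast
      then have "y = component_aut \<phi> i (fst g i)"
        using Aut0_component[OF i g(1)] fst_incl[of y] by simp
      then show "y \<in> component_aut \<phi> i ` carrier (Gs i)"
        using component_closed[OF g(1) i] by blast
    qed
  qed auto
  moreover have "component_aut \<phi> i \<in> extensional (carrier (Gs i))"
    by (simp add: component_aut_def)
  ultimately show ?thesis
    using component_aut_hom[OF i] by (simp add: auto_def Bij_def bij_betw_def)
qed

lemma funpow_Aut0_closed: "g \<in> carrier P \<Longrightarrow> (\<phi> ^^ n) g \<in> carrier P"
  by (induction n) auto

lemma funpow_Aut0_component:
  assumes "i \<in> {1..k}" "g \<in> carrier P"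
  shows "fst ((\<phi> ^^ n) g) i = (component_aut \<phi> i ^^ n) (fst g i)"
  using assms by (induction n) (auto simp: Aut0_component funpow_Aut0_closed)

end

end

lemma funpow_ab_map_ab_elem:
  assumes "group G" "\<chi> \<in> auto G" "q \<in> carrier G"
  shows "(ab_map \<chi> ^^ n) (ab_elem G q) = ab_elem G ((\<chi> ^^ n) q)"
proof (induction n)
  case (Suc n)
  have "\<chi> x \<in> carrier G" if "x \<in> carrier G" for x
    using assms(2) that by (auto simp: auto_def hom_def)
  then have "(\<chi> ^^ n) q \<in> carrier G"
    using assms(3) by (induction n) auto
  then show ?case using Suc ab_map_ab_elem[OF assms(1,2)] by simp
qed simp


section \<open>Exponential polynomial growth\<close>

lemma growth_le_eventually:
  assumes le: "\<And>n. n \<ge> N \<Longrightarrow> a n \<le> C * b n" and pos: "\<And>n. b n > 0"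
  shows "a \<preceq> b"
proof -
  define D where "D = \<bar>C\<bar> + 1 + (\<Sum>n<N. \<bar>a n\<bar> / b n)"
  have sum: "(\<Sum>n<N. \<bar>a n\<bar> / b n) \<ge> 0"
    using pos by (intro sum_nonneg divide_nonneg_pos) auto
  have "a n \<le> D * b n" for n
  proof (cases "n < N")
    case True
    have "\<bar>a n\<bar> / b n \<le> (\<Sum>n<N. \<bar>a n\<bar> / b n)"
      using True pos by (intro member_le_sum) (auto simp: less_imp_le)
    then have "\<bar>a n\<bar> / b n \<le> D" unfolding D_def by linarith
    then have "\<bar>a n\<bar> \<le> D * b n" using pos[of n] by (simp add: divide_le_eq)
    then show ?thesis by linarith
  next
    case False
    then have "a n \<le> C * b n" using le by simp
    also have "\<dots> \<le> D * b n"
      using pos[of n] sum by (intro mult_right_mono) (auto simp: D_def)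
    finally show ?thesis .
  qed
  moreover have "D > 0" using sum by (simp add: D_def)
  ultimately show ?thesis by (rule growth_leI[rotated])
qed

text \<open>The value \<open>1\<close> at \<open>n = 0\<close> keeps the sequence positive for \<open>p > 0\<close>.\<close>

definition poly_exp :: "nat \<Rightarrow> real \<Rightarrow> nat \<Rightarrow> real" where
  "poly_exp p r n = (if n = 0 then 1 else real n ^ p * r ^ n)"

lemma poly_exp_pos: "r > 0 \<Longrightarrow> poly_exp p r n > 0"
  by (simp add: poly_exp_def)

lemma poly_exp_le_same_base:
  assumes "p \<le> q" "r > 0"
  shows "poly_exp p r \<preceq> poly_exp q r"
  using assms by (intro growth_le_mono) (auto simp: poly_exp_def intro!: mult_right_mono power_increasing)

lemma poly_exp_le_smaller_base:
  assumes "0 < r" "r < s"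
  shows "poly_exp p r \<preceq> poly_exp q s"
proof -
  obtain C where C: "\<And>n. 1 * (r / s) ^ n * of_nat n ^ p \<le> C"
    using poly_exp_constant_bound[of "r / s" 1 p] assms by auto
  have "poly_exp p r n \<le> C * poly_exp q s n" if "n \<ge> 1" for n
  proof -
    have "real n ^ p * r ^ n = (r / s) ^ n * real n ^ p * s ^ n"
      using assms by (simp add: power_divide)
    also have "\<dots> \<le> C * s ^ n"
      using C[of n] assms by (intro mult_right_mono) auto
    also have "\<dots> \<le> C * (real n ^ q * s ^ n)"
    proof (rule mult_left_mono)
      show "s ^ n \<le> real n ^ q * s ^ n" using that assms by simp
      have "0 \<le> 1 * (r / s) ^ n * of_nat n ^ p" using assms by simp
      then show "0 \<le> C" using C[of n] by linarith
    qed
    finally show ?thesis using that by (simp add: poly_exp_def)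
  qed
  then show ?thesis using assms by (intro growth_le_eventually[of 1 _ C] poly_exp_pos) auto
qed

lemma poly_exp_linear:
  assumes "0 < r" "0 < s"
  shows "poly_exp p r \<preceq> poly_exp q s \<or> poly_exp q s \<preceq> poly_exp p r"
proof (cases r s rule: linorder_cases)
  case equal
  then show ?thesis using assms poly_exp_le_same_base[of p q r] poly_exp_le_same_base[of q p r] by (cases "p \<le> q") auto
qed (use assms poly_exp_le_smaller_base in blast)+

lemma growth_eq_add_absorb:
  assumes "a \<preceq> c" "b \<simeq> (c :: nat \<Rightarrow> real)" "\<And>n. 0 \<le> a n"
  shows "(\<lambda>n. a n + b n) \<simeq> c"
proof -
  have "b \<preceq> (\<lambda>n. a n + b n)" using assms(3) by (intro growth_le_mono) simp
  with assms show ?thesis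
    unfolding growth_eq_def by (blast intro: growth_le_add growth_le_trans)
qed


section \<open>Growth of matrix powers\<close>

definition l1_norm :: "'a :: real_normed_vector vec \<Rightarrow> real" where
  "l1_norm v = (\<Sum>i<dim_vec v. norm (v $ i))"

lemma l1_norm_nonneg: "l1_norm v \<ge> 0"
  by (simp add: l1_norm_def sum_nonneg)

lemma l1_norm_append: "l1_norm (v @\<^sub>v w) = l1_norm v + l1_norm w"
proof -
  have "(\<Sum>i<a + b. f i) = (\<Sum>i<a. f i) + (\<Sum>i<b. f (a + i))" for a b and f :: "nat \<Rightarrow> real"
    by (induction b) auto
  then show ?thesis by (simp add: l1_norm_def)
qed

lemma norm_index_le_l1_norm: "i < dim_vec v \<Longrightarrow> norm (v $ i) \<le> l1_norm v"
  unfolding l1_norm_def using member_le_sum[of i "{..<dim_vec v}" "\<lambda>i. norm (v $ i)"] by simp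

lemma index_mult_mat_vec_sum:
  assumes "M \<in> carrier_mat m s" "v \<in> carrier_vec s" "i < m"
  shows "(M *\<^sub>v v) $ i = (\<Sum>j<s. M $$ (i, j) * v $ j)"
  using assms by (auto simp: scalar_prod_def lessThan_atLeast0 intro!: sum.cong)

lemma l1_norm_mult_mat_vec_le:
  fixes M :: "'a :: real_normed_field mat"
  assumes M: "M \<in> carrier_mat m s"
  shows "\<exists>C>0. \<forall>v\<in>carrier_vec s. l1_norm (M *\<^sub>v v) \<le> C * l1_norm v"
proof -
  define C where "C = 1 + (\<Sum>i<m. \<Sum>j<s. norm (M $$ (i, j)))"
  have "l1_norm (M *\<^sub>v v) \<le> C * l1_norm v" if v: "v \<in> carrier_vec s" for v
  proof -
    have "l1_norm (M *\<^sub>v v) = (\<Sum>i<m. norm (\<Sum>j<s. M $$ (i, j) * v $ j))"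
      using M v by (auto simp: l1_norm_def index_mult_mat_vec_sum[OF M v] intro!: sum.cong simp del: index_mult_mat_vec)
    also have "\<dots> \<le> (\<Sum>i<m. \<Sum>j<s. norm (M $$ (i, j)) * l1_norm v)"
      using v by (intro sum_mono sum_norm_le) (auto simp: norm_mult intro!: mult_left_mono norm_index_le_l1_norm)
    also have "\<dots> = (\<Sum>i<m. \<Sum>j<s. norm (M $$ (i, j))) * l1_norm v"
      by (simp add: sum_distrib_right)
    also have "\<dots> \<le> C * l1_norm v"
      by (intro mult_right_mono) (auto simp: C_def l1_norm_nonneg)
    finally show ?thesis .
  qed
  moreover have "C > 0" unfolding C_def by (intro add_pos_nonneg sum_nonneg) auto
  ultimately show ?thesis by blast
qed

text \<open>Only the last nonzero coordinate \<open>t\<close> of \<open>w\<close> matters. Every coordinate of the \<open>n\<close>-th image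
  is a sum of terms of order at most \<open>n\<^sup>t \<bar>\<mu>\<bar>\<^sup>n\<close>, and in coordinate \<open>0\<close> the term of the
  binomial coefficient \<open>n choose t\<close> dominates the others.\<close>

lemma jordan_block_growth:
  fixes \<mu> :: "'a :: real_normed_field"
  assumes \<mu>: "\<mu> \<noteq> 0" and w: "w \<in> carrier_vec s" "w \<noteq> 0\<^sub>v s"
  shows "\<exists>t. (\<lambda>n. l1_norm (jordan_block s \<mu> ^\<^sub>m n *\<^sub>v w)) \<simeq> poly_exp t (norm \<mu>)"
proof -
  define t where "t = Max {i. i < s \<and> w $ i \<noteq> 0}"
  have "{i. i < s \<and> w $ i \<noteq> 0} \<noteq> {}"
    using w by (auto simp: vec_eq_iff)
  then have "t \<in> {i. i < s \<and> w $ i \<noteq> 0}"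
    unfolding t_def by (intro Max_in) auto
  then have t: "t < s" "w $ t \<noteq> 0" by auto
  have above: "w $ i = 0" if "i < s" "t < i" for i
  proof (rule ccontr)
    assume "w $ i \<noteq> 0"
    then have "i \<le> t" unfolding t_def using that by (intro Max_ge) auto
    then show False using that by simp
  qed
  let ?r = "norm \<mu>" and ?x = "\<lambda>n. jordan_block s \<mu> ^\<^sub>m n *\<^sub>v w"
  define u where "u n i j = (if i \<le> j then of_nat (n choose (j - i)) * \<mu> ^ (n + i - j) else 0) * w $ j" for n i j
  have r: "?r > 0" using \<mu> by simp
  have dim: "dim_vec (?x n) = s" for n by simp
  have x: "?x n $ i = (\<Sum>j<s. u n i j)" if "i < s" for n i
    using that w by (subst index_mult_mat_vec_sum[of _ s s]) (auto simp: u_def jordan_block_pow)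
  have x': "?x n $ i = (\<Sum>j\<le>t. u n i j)" if "i < s" for n i
    unfolding x[OF that]
    using t above by (intro sum.mono_neutral_right) (auto simp: u_def not_le)
  have bound: "norm (of_nat (n choose d) * \<mu> ^ (n - d) :: 'a) \<le> real n ^ d * ?r ^ n / ?r ^ d" for n d
  proof (cases "d \<le> n")
    case True
    have "real (n choose d) \<le> real n ^ d"
      using binomial_le_pow[OF True] by (metis of_nat_le_iff of_nat_power)
    moreover have "?r ^ (n - d) = ?r ^ n / ?r ^ d"
      using True r by (simp add: power_diff)
    ultimately show ?thesis
      using r by (simp add: norm_mult norm_power mult_right_mono divide_right_mono)
  next
    case False
    then show ?thesis using r by (simp add: binomial_eq_0)
  qed
  have upper: "(\<lambda>n. norm (u n i j)) \<preceq> poly_exp t ?r" if "i < s" "j \<le> t" for i j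
  proof (cases "i \<le> j")
    case True
    let ?d = "j - i"
    have le: "norm (u n i j) \<le> (norm (w $ j) / ?r ^ ?d) * poly_exp t ?r n" if "n \<ge> 1" for n
    proof -
      have "norm (u n i j) = norm (of_nat (n choose ?d) * \<mu> ^ (n - ?d)) * norm (w $ j)"
        using True by (simp add: u_def norm_mult)
      also have "\<dots> \<le> real n ^ ?d * ?r ^ n / ?r ^ ?d * norm (w $ j)"
        by (intro mult_right_mono bound) auto
      also have "\<dots> \<le> real n ^ t * ?r ^ n / ?r ^ ?d * norm (w $ j)"
        using that \<open>j \<le> t\<close> r by (intro mult_right_mono divide_right_mono power_increasing) auto
      finally show ?thesis using that by (simp add: poly_exp_def mult_ac)
    qed
    show ?thesis using le poly_exp_pos[OF r] by (rule growth_le_eventually)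
  next
    case False
    then show ?thesis
      using r by (intro growth_le_mono) (auto simp: u_def less_imp_le poly_exp_pos)
  qed
  have "(\<lambda>n. l1_norm (?x n)) \<preceq> (\<lambda>n. \<Sum>i<s. \<Sum>j\<le>t. norm (u n i j))"
    unfolding l1_norm_def dim
    by (intro growth_le_mono sum_mono) (auto simp: x' norm_sum simp del: index_mult_mat_vec)
  also have "\<dots> \<preceq> poly_exp t ?r"
    using upper r by (intro growth_le_sum) (auto simp: less_imp_le poly_exp_pos)
  finally have "(\<lambda>n. l1_norm (?x n)) \<preceq> poly_exp t ?r" .

  moreover have "poly_exp t ?r \<preceq> (\<lambda>n. l1_norm (?x n))"
  proof -
    define c where "c = norm (w $ t) / (?r ^ t * real t ^ t)"
    define D where "D = (\<Sum>j<t. norm (w $ j) / ?r ^ j)"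
    have c: "c > 0" using t r by (cases "t = 0") (auto simp: c_def)
    \<comment> \<open>In coordinate \<open>0\<close>, the term \<open>t\<close> is at least \<open>c n\<^sup>t \<bar>\<mu>\<bar>\<^sup>n\<close>, and the others add up to at most
      \<open>(D / n) n\<^sup>t \<bar>\<mu>\<bar>\<^sup>n\<close>. From \<open>N\<close> on, this is at most half of it.\<close>
    obtain N where N: "real N \<ge> 2 * D / c" using real_arch_simple by blast
    have lower: "poly_exp t ?r n \<le> 2 / c * l1_norm (?x n)" if n: "n \<ge> Max {1, t, N}" for n
    proof -
      have n1: "n \<ge> 1" "n \<ge> t" "n \<ge> N" using n by auto
      have "D / n \<le> c / 2"
      proof -
        have "2 * D / c \<le> real n" using N n1(3) by linarith
        then show ?thesis using c n1(1) by (simp add: field_simps)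
      qed
      have small: "(\<Sum>j<t. norm (u n 0 j)) \<le> D / n * (real n ^ t * ?r ^ n)"
      proof -
        have "norm (u n 0 j) \<le> norm (w $ j) / ?r ^ j * (real n ^ t * ?r ^ n / n)" if j: "j < t" for j
        proof -
          have "real n ^ j * real n \<le> real n ^ t"
            using j n1(1) power_increasing[of "Suc j" t "real n"] by (simp add: mult.commute)
          then have pw: "real n ^ j \<le> real n ^ t / n"
            using n1(1) by (simp add: le_divide_eq)
          have "norm (u n 0 j) = norm (of_nat (n choose j) * \<mu> ^ (n - j)) * norm (w $ j)"
            by (simp add: u_def norm_mult)
          also have "\<dots> \<le> real n ^ j * ?r ^ n / ?r ^ j * norm (w $ j)"
            by (intro mult_right_mono bound) auto
          also have "\<dots> \<le> (real n ^ t / n) * ?r ^ n / ?r ^ j * norm (w $ j)"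
            using pw r by (intro mult_right_mono divide_right_mono) auto
          finally show ?thesis by (simp add: mult_ac)
        qed
        then have "(\<Sum>j<t. norm (u n 0 j)) \<le> (\<Sum>j<t. norm (w $ j) / ?r ^ j * (real n ^ t * ?r ^ n / n))"
          by (intro sum_mono) auto
        also have "\<dots> = D * (real n ^ t * ?r ^ n / n)"
          unfolding D_def sum_distrib_right ..
        finally show ?thesis by simp
      qed
      have large: "c * (real n ^ t * ?r ^ n) \<le> norm (u n 0 t)"
      proof -
        have "(real n / real t) ^ t \<le> real (n choose t)"
          using n1(2) by (rule binomial_ge_n_over_k_pow_k)
        then have "(real n / real t) ^ t * (?r ^ n / ?r ^ t * norm (w $ t)) \<le>
            real (n choose t) * (?r ^ n / ?r ^ t * norm (w $ t))"
          by (intro mult_right_mono) auto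
        also have "\<dots> = norm (u n 0 t)"
          using n1(2) r by (simp add: u_def norm_mult norm_power norm_divide power_diff)
        finally show ?thesis
          by (simp add: c_def power_divide mult_ac)
      qed
      have "?x n $ 0 = u n 0 t + (\<Sum>j<t. u n 0 j)"
        using t(1) by (subst x') (auto simp: sum.lessThan_Suc lessThan_Suc_atMost[symmetric])
      then have "norm (u n 0 t) \<le> norm (?x n $ 0) + norm (\<Sum>j<t. u n 0 j)"
        by (metis add_diff_cancel_right' norm_triangle_ineq4)
      also have "norm (\<Sum>j<t. u n 0 j) \<le> (\<Sum>j<t. norm (u n 0 j))"
        by (rule norm_sum)
      finally have "c * (real n ^ t * ?r ^ n) \<le> norm (?x n $ 0) + D / n * (real n ^ t * ?r ^ n)"
        using small large by linarith
      also have "D / n * (real n ^ t * ?r ^ n) \<le> c / 2 * (real n ^ t * ?r ^ n)"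
        using \<open>D / n \<le> c / 2\<close> r by (intro mult_right_mono) auto
      finally have "c / 2 * (real n ^ t * ?r ^ n) \<le> norm (?x n $ 0)"
        by (simp add: field_simps)
      also have "\<dots> \<le> l1_norm (?x n)"
        using t(1) by (intro norm_index_le_l1_norm) simp
      finally show ?thesis
        using n1(1) c by (simp add: poly_exp_def field_simps)
    qed
    \<comment> \<open>The finitely many remaining \<open>n\<close> only need a norm that does not vanish; coordinate \<open>t\<close> is
      \<open>\<mu>\<^sup>n\<close> times the old one.\<close>
    have pos: "l1_norm (?x n) > 0" for n
    proof -
      have "?x n $ t = (\<Sum>j\<in>{t}. u n t j)"
        unfolding x'[OF t(1)] by (intro sum.mono_neutral_right) (auto simp: u_def)
      then have "?x n $ t \<noteq> 0"
        using t \<mu> by (simp add: u_def)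
      then show ?thesis
        using norm_index_le_l1_norm[of t "?x n"] t(1) by (simp add: less_le_trans[OF zero_less_norm_iff[THEN iffD2]])
    qed
    show ?thesis using lower pos by (rule growth_le_eventually)
  qed
  ultimately show ?thesis unfolding growth_eq_def by blast
qed

text \<open>A block diagonal matrix acts on the blocks separately, and the norm is additive over them. As
  any two of the sequences \<^const>\<open>poly_exp\<close> are comparable, one block dominates.\<close>

lemma jordan_matrix_growth:
  fixes w :: "'a :: real_normed_field vec"
  assumes "\<And>s \<mu>. (s, \<mu>) \<in> set n_as \<Longrightarrow> \<mu> \<noteq> 0"
    and "w \<in> carrier_vec (sum_list (map fst n_as))" "w \<noteq> 0\<^sub>v (sum_list (map fst n_as))"
  shows "\<exists>\<mu> p. \<mu> \<in> snd ` set n_as \<and>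
    (\<lambda>n. l1_norm (jordan_matrix n_as ^\<^sub>m n *\<^sub>v w)) \<simeq> poly_exp p (norm \<mu>)"
  using assms
proof (induction n_as arbitrary: w)
  case Nil
  then show ?case by (auto simp: vec_eq_iff)
next
  case (Cons b n_as)
  obtain s \<mu> where b: "b = (s, \<mu>)" by force
  let ?m = "sum_list (map fst n_as)" and ?J = "jordan_block s \<mu>" and ?K = "jordan_matrix n_as"
  define v where "v = vec_first w s"
  define v' where "v' = vec_last w ?m"
  have v: "v \<in> carrier_vec s" "v' \<in> carrier_vec ?m" "v @\<^sub>v v' = w"
    using Cons.prems(2) by (auto simp: v_def v'_def b)
  have \<mu>: "\<mu> \<noteq> 0" using Cons.prems(1)[of s \<mu>] b by simp
  have head: "\<mu> \<in> snd ` set (b # n_as)" by (simp add: b)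
  have split: "l1_norm (jordan_matrix (b # n_as) ^\<^sub>m n *\<^sub>v w) = l1_norm (?J ^\<^sub>m n *\<^sub>v v) + l1_norm (?K ^\<^sub>m n *\<^sub>v v')" for n
  proof -
    have "jordan_matrix (b # n_as) ^\<^sub>m n = four_block_mat (?J ^\<^sub>m n) (0\<^sub>m s ?m) (0\<^sub>m ?m s) (?K ^\<^sub>m n)"
      unfolding b jordan_matrix_Cons by (rule pow_four_block_mat) auto
    moreover have "?J ^\<^sub>m n \<in> carrier_mat s s" "?K ^\<^sub>m n \<in> carrier_mat ?m ?m"
      by (intro pow_carrier_mat; simp)+
    note mult_mat_vec_split[OF this v(1,2)]
    ultimately have "jordan_matrix (b # n_as) ^\<^sub>m n *\<^sub>v w = (?J ^\<^sub>m n *\<^sub>v v) @\<^sub>v (?K ^\<^sub>m n *\<^sub>v v')"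
      by (simp add: v(3))
    then show ?thesis by (simp add: l1_norm_append)
  qed
  have zero: "l1_norm (M *\<^sub>v 0\<^sub>v q) = 0" if "M \<in> carrier_mat q q" for M :: "'a mat" and q
    using that by (simp add: l1_norm_def)
  have zeroJ: "l1_norm (?J ^\<^sub>m n *\<^sub>v 0\<^sub>v s) = 0" and zeroK: "l1_norm (?K ^\<^sub>m n *\<^sub>v 0\<^sub>v ?m) = 0" for n
    by (intro zero pow_carrier_mat; simp)+
  have IH: "\<exists>\<nu> q. \<nu> \<in> snd ` set n_as \<and> (\<lambda>n. l1_norm (?K ^\<^sub>m n *\<^sub>v v')) \<simeq> poly_exp q (norm \<nu>)"
    if "v' \<noteq> 0\<^sub>v ?m"
    using Cons.prems(1) v(2) that by (intro Cons.IH) auto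
  have block: "\<exists>p. (\<lambda>n. l1_norm (?J ^\<^sub>m n *\<^sub>v v)) \<simeq> poly_exp p (norm \<mu>)" if "v \<noteq> 0\<^sub>v s"
    using \<mu> v(1) that by (rule jordan_block_growth)
  consider "v = 0\<^sub>v s" "v' \<noteq> 0\<^sub>v ?m" | "v \<noteq> 0\<^sub>v s" "v' = 0\<^sub>v ?m" | "v \<noteq> 0\<^sub>v s" "v' \<noteq> 0\<^sub>v ?m"
    using Cons.prems(3) v(3) b by fastforce
  then show ?case
  proof cases
    case 1
    then show ?thesis using IH by (auto simp: split zeroJ)
  next
    case 2
    then obtain p where "(\<lambda>n. l1_norm (?J ^\<^sub>m n *\<^sub>v v)) \<simeq> poly_exp p (norm \<mu>)"
      using block by blast
    then have "(\<lambda>n. l1_norm (jordan_matrix (b # n_as) ^\<^sub>m n *\<^sub>v w)) \<simeq> poly_exp p (norm \<mu>)"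
      by (simp add: split 2(2) zeroK)
    then show ?thesis using head by blast
  next
    case 3
    obtain p where p: "(\<lambda>n. l1_norm (?J ^\<^sub>m n *\<^sub>v v)) \<simeq> poly_exp p (norm \<mu>)"
      using block 3 by blast
    obtain \<nu> q where q: "\<nu> \<in> snd ` set n_as" "(\<lambda>n. l1_norm (?K ^\<^sub>m n *\<^sub>v v')) \<simeq> poly_exp q (norm \<nu>)"
      using IH 3 by blast
    obtain s' where "(s', \<nu>) \<in> set n_as" using q(1) by auto
    then have \<nu>: "\<nu> \<noteq> 0" using Cons.prems(1)[of s' \<nu>] by simp
    show ?thesis
    proof (cases "poly_exp p (norm \<mu>) \<preceq> poly_exp q (norm \<nu>)")
      case True
      have "(\<lambda>n. l1_norm (?J ^\<^sub>m n *\<^sub>v v)) \<preceq> poly_exp q (norm \<nu>)"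
        using p True growth_le_trans unfolding growth_eq_def by blast
      then have "(\<lambda>n. l1_norm (?J ^\<^sub>m n *\<^sub>v v) + l1_norm (?K ^\<^sub>m n *\<^sub>v v')) \<simeq> poly_exp q (norm \<nu>)"
        using q(2) l1_norm_nonneg by (rule growth_eq_add_absorb)
      then show ?thesis using q(1) by (auto simp: split)
    next
      case False
      then have "poly_exp q (norm \<nu>) \<preceq> poly_exp p (norm \<mu>)"
        using poly_exp_linear[of "norm \<mu>" "norm \<nu>" p q] \<mu> \<nu> by auto
      then have "(\<lambda>n. l1_norm (?K ^\<^sub>m n *\<^sub>v v')) \<preceq> poly_exp p (norm \<mu>)"
        using q(2) growth_le_trans unfolding growth_eq_def by blast
      then have "(\<lambda>n. l1_norm (?K ^\<^sub>m n *\<^sub>v v') + l1_norm (?J ^\<^sub>m n *\<^sub>v v)) \<simeq> poly_exp p (norm \<mu>)"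
        using p l1_norm_nonneg by (rule growth_eq_add_absorb)
      then have "(\<lambda>n. l1_norm (jordan_matrix (b # n_as) ^\<^sub>m n *\<^sub>v w)) \<simeq> poly_exp p (norm \<mu>)"
        by (simp add: split add.commute)
      then show ?thesis using head by blast
    qed
  qed
qed

text \<open>Passing to the Jordan normal form changes the norm by at most a factor.\<close>

lemma matrix_power_growth:
  fixes M :: "complex mat"
  assumes M: "M \<in> carrier_mat m m" and det: "det M \<noteq> 0" and v: "v \<in> carrier_vec m" "v \<noteq> 0\<^sub>v m"
  shows "\<exists>\<mu> p. eigenvalue M \<mu> \<and> \<mu> \<noteq> 0 \<and> (\<lambda>n. l1_norm (M ^\<^sub>m n *\<^sub>v v)) \<simeq> poly_exp p (norm \<mu>)"
proof -
  obtain as where "char_poly M = (\<Prod>a\<leftarrow>as. [:- a, 1:])"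
    using char_poly_factorized[OF M] by blast
  then obtain n_as where jnf: "jordan_nf M n_as"
    using jordan_nf_exists[OF M] by blast
  let ?J = "jordan_matrix n_as" and ?d = "sum_list (map fst n_as)"
  obtain P Q where wit: "similar_mat_wit M ?J P Q"
    using jnf unfolding jordan_nf_def similar_mat_def by blast
  have PQ: "P * Q = 1\<^sub>m m" "Q * P = 1\<^sub>m m" "P \<in> carrier_mat m m" "Q \<in> carrier_mat m m"
    "?J \<in> carrier_mat m m"
    using similar_mat_witD2[OF M wit] by auto
  have d: "?d = m"
    using carrier_matD(1)[OF PQ(5)] by simp
  have eig: "eigenvalue M \<mu>" "\<mu> \<noteq> 0" if "(s, \<mu>) \<in> set n_as" for s \<mu>
  proof -
    have "s \<noteq> 0" using jnf that by (force simp: jordan_nf_def)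
    moreover have "[:- \<mu>, 1:] ^ s dvd char_poly M"
    proof -
      obtain xs ys where "n_as = xs @ (s, \<mu>) # ys"
        using \<open>(s, \<mu>) \<in> set n_as\<close> by (meson split_list)
      then show ?thesis
        unfolding jordan_nf_char_poly[OF jnf] by simp
    qed
    moreover have "[:- \<mu>, 1:] dvd [:- \<mu>, 1:] ^ s"
      using \<open>s \<noteq> 0\<close> by (simp add: dvd_power)
    ultimately have "[:- \<mu>, 1:] dvd char_poly M"
      by (meson dvd_trans)
    then show e: "eigenvalue M \<mu>"
      by (simp add: eigenvalue_root_char_poly[OF M] poly_eq_0_iff_dvd)
    show "\<mu> \<noteq> 0"
    proof
      assume "\<mu> = 0"
      then obtain x where "x \<in> carrier_vec m" "x \<noteq> 0\<^sub>v m" "M *\<^sub>v x = 0 \<cdot>\<^sub>v x"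
        using e M by (auto simp: eigenvalue_def eigenvector_def)
      moreover from this have "0 \<cdot>\<^sub>v x = 0\<^sub>v m" by auto
      ultimately have "det M = 0"
        using det_0_iff_vec_prod_zero[OF M] by auto
      with det show False by simp
    qed
  qed
  have Qv: "Q *\<^sub>v v \<in> carrier_vec m" "Q *\<^sub>v v \<noteq> 0\<^sub>v m"
  proof -
    show "Q *\<^sub>v v \<in> carrier_vec m" using PQ v by auto
    have "P *\<^sub>v (Q *\<^sub>v v) = v"
      using assoc_mult_mat_vec[OF PQ(3,4) v(1)] PQ(1) v(1) by simp
    moreover have "P *\<^sub>v 0\<^sub>v m = 0\<^sub>v m" using PQ(3) by auto
    ultimately show "Q *\<^sub>v v \<noteq> 0\<^sub>v m"
      using v(2) by auto
  qed
  obtain \<mu> p where \<mu>: "\<mu> \<in> snd ` set n_as" and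
    p: "(\<lambda>n. l1_norm (?J ^\<^sub>m n *\<^sub>v (Q *\<^sub>v v))) \<simeq> poly_exp p (norm \<mu>)"
    using jordan_matrix_growth[of n_as "Q *\<^sub>v v"] eig(2) Qv d by auto
  have Jn: "?J ^\<^sub>m n *\<^sub>v (Q *\<^sub>v v) \<in> carrier_vec m" and Mn: "M ^\<^sub>m n *\<^sub>v v \<in> carrier_vec m" for n
    by (intro mult_mat_vec_carrier[of _ m m] pow_carrier_mat PQ(5) Qv M v)+
  have conj: "M ^\<^sub>m n *\<^sub>v v = P *\<^sub>v (?J ^\<^sub>m n *\<^sub>v (Q *\<^sub>v v))" for n
  proof -
    have Jp: "?J ^\<^sub>m n \<in> carrier_mat m m" using PQ(5) by (rule pow_carrier_mat)
    have "M ^\<^sub>m n = P * ?J ^\<^sub>m n * Q"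
      by (rule similar_mat_wit_pow_id[OF wit])
    then show ?thesis
      using assoc_mult_mat_vec[OF mult_carrier_mat[OF PQ(3) Jp] PQ(4) v(1)]
        assoc_mult_mat_vec[OF PQ(3) Jp Qv(1)] by simp
  qed
  then have conj': "?J ^\<^sub>m n *\<^sub>v (Q *\<^sub>v v) = Q *\<^sub>v (M ^\<^sub>m n *\<^sub>v v)" for n
    using assoc_mult_mat_vec[OF PQ(4,3) Jn[of n]] PQ(2) Jn[of n] by simp
  have "(\<lambda>n. l1_norm (M ^\<^sub>m n *\<^sub>v v)) \<preceq> (\<lambda>n. l1_norm (?J ^\<^sub>m n *\<^sub>v (Q *\<^sub>v v)))"
  proof -
    obtain C where "C > 0" "\<And>y. y \<in> carrier_vec m \<Longrightarrow> l1_norm (P *\<^sub>v y) \<le> C * l1_norm y"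
      using l1_norm_mult_mat_vec_le[OF PQ(3)] by blast
    then show ?thesis unfolding conj using Jn by (intro growth_leI[of C]) auto
  qed
  moreover have "(\<lambda>n. l1_norm (?J ^\<^sub>m n *\<^sub>v (Q *\<^sub>v v))) \<preceq> (\<lambda>n. l1_norm (M ^\<^sub>m n *\<^sub>v v))"
  proof -
    obtain C where "C > 0" "\<And>y. y \<in> carrier_vec m \<Longrightarrow> l1_norm (Q *\<^sub>v y) \<le> C * l1_norm y"
      using l1_norm_mult_mat_vec_le[OF PQ(4)] by blast
    then show ?thesis unfolding conj' using Mn by (intro growth_leI[of C]) auto
  qed
  ultimately have "(\<lambda>n. l1_norm (M ^\<^sub>m n *\<^sub>v v)) \<simeq> (\<lambda>n. l1_norm (?J ^\<^sub>m n *\<^sub>v (Q *\<^sub>v v)))"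
    unfolding growth_eq_def by (rule conjI)
  then have "(\<lambda>n. l1_norm (M ^\<^sub>m n *\<^sub>v v)) \<simeq> poly_exp p (norm \<mu>)"
    using p by (rule growth_eq_trans)
  moreover obtain s where "(s, \<mu>) \<in> set n_as" using \<mu> by auto
  ultimately show ?thesis using eig by blast
qed


section \<open>Integer matrices\<close>

abbreviation complex_mat :: "int mat \<Rightarrow> complex mat" where
  "complex_mat \<equiv> map_mat of_int"

lemma eigenvalue_algebraic_int:
  assumes B: "B \<in> carrier_mat m m" and "eigenvalue (complex_mat B) \<mu>"
  shows "algebraic_int \<mu>"
proof -
  have "poly (char_poly (complex_mat B)) \<mu> = 0"
    using assms eigenvalue_root_char_poly[of "complex_mat B" m \<mu>] by simp
  then have "poly (map_poly of_int (char_poly B)) \<mu> = 0"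
    by (simp add: of_int_hom.char_poly_hom[OF B])
  moreover have "lead_coeff (char_poly B) = 1"
    using degree_monic_char_poly[OF B] by simp
  ultimately show ?thesis
    unfolding algebraic_int_altdef_ipoly by blast
qed

text \<open>If \<open>B x = \<mu> x\<close> for an integer matrix \<open>B\<close>, then conjugation gives an eigenvector for
  \<open>cnj \<mu>\<close>, and the tensor product of the two is an eigenvector of the integer matrix
  \<open>B \<otimes> B\<close> with eigenvalue \<open>\<bar>\<mu>\<bar>\<^sup>2\<close>.\<close>

lemma norm_eigenvalue_algebraic_int:
  assumes B: "B \<in> carrier_mat m m" and "eigenvalue (complex_mat B) \<mu>"
  shows "algebraic_int (norm \<mu>)"
proof -
  define K where "K = mat (m * m) (m * m) (\<lambda>(a, b). B $$ (a div m, b div m) * B $$ (a mod m, b mod m))"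
  have K: "K \<in> carrier_mat (m * m) (m * m)" by (simp add: K_def)
  obtain x where x: "x \<in> carrier_vec m" "x \<noteq> 0\<^sub>v m" "complex_mat B *\<^sub>v x = \<mu> \<cdot>\<^sub>v x"
    using assms by (auto simp: eigenvalue_def eigenvector_def)
  have Bx: "(\<Sum>j<m. of_int (B $$ (i, j)) * x $ j) = \<mu> * x $ i" if "i < m" for i
  proof -
    have "(complex_mat B *\<^sub>v x) $ i = (\<Sum>j<m. complex_mat B $$ (i, j) * x $ j)"
      using B x(1) that by (intro index_mult_mat_vec_sum) auto
    then show ?thesis using x that B by simp
  qed
  have Bx': "(\<Sum>j<m. of_int (B $$ (i, j)) * cnj (x $ j)) = cnj \<mu> * cnj (x $ i)" if "i < m" for i
    using arg_cong[OF Bx[OF that], of cnj] by simp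
  define y where "y = vec (m * m) (\<lambda>a. x $ (a div m) * cnj (x $ (a mod m)))"
  have y: "y \<in> carrier_vec (m * m)" by (simp add: y_def)
  have lt: "a div m < m" "a mod m < m" if "a < m * m" for a
  proof -
    have "m > 0" using that by (cases m) auto
    then show "a div m < m" "a mod m < m"
      using that by (auto simp: less_mult_imp_div_less)
  qed
  have lt': "q * m + r < m * m" if "q < m" "r < m" for q r
  proof -
    have "q * m + r < Suc q * m" using that by simp
    also have "\<dots> \<le> m * m" using that by (intro mult_right_mono) auto
    finally show ?thesis .
  qed
  \<comment> \<open>An index \<open>a < m * m\<close> stands for the pair \<open>(a div m, a mod m)\<close>.\<close>
  have "complex_mat K *\<^sub>v y = (\<mu> * cnj \<mu>) \<cdot>\<^sub>v y"
  proof (rule eq_vecI)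
    fix a assume "a < dim_vec ((\<mu> * cnj \<mu>) \<cdot>\<^sub>v y)"
    then have a: "a < m * m" by (simp add: y_def)
    have "(complex_mat K *\<^sub>v y) $ a = (\<Sum>b<m * m. complex_mat K $$ (a, b) * y $ b)"
      using K y a by (intro index_mult_mat_vec_sum) auto
    also have "\<dots> = (\<Sum>b<m * m. (of_int (B $$ (a div m, b div m)) * x $ (b div m)) *
        (of_int (B $$ (a mod m, b mod m)) * cnj (x $ (b mod m))))"
      using a by (intro sum.cong) (auto simp: K_def y_def)
    also have "\<dots> = (\<Sum>(q, r)\<in>{..<m} \<times> {..<m}. (of_int (B $$ (a div m, q)) * x $ q) *
        (of_int (B $$ (a mod m, r)) * cnj (x $ r)))"
      using lt lt'
      by (intro sum.reindex_bij_witness[of _ "\<lambda>(q, r). q * m + r" "\<lambda>b. (b div m, b mod m)"]) auto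
    also have "\<dots> = (\<Sum>q<m. of_int (B $$ (a div m, q)) * x $ q) *
        (\<Sum>r<m. of_int (B $$ (a mod m, r)) * cnj (x $ r))"
      by (simp add: sum_product sum.cartesian_product)
    also have "\<dots> = ((\<mu> * cnj \<mu>) \<cdot>\<^sub>v y) $ a"
      using a lt[OF a] by (simp add: Bx Bx' y_def)
    finally show "(complex_mat K *\<^sub>v y) $ a = ((\<mu> * cnj \<mu>) \<cdot>\<^sub>v y) $ a" .
  qed (simp add: K_def y_def)
  moreover have "y \<noteq> 0\<^sub>v (m * m)"
  proof -
    obtain i where i: "i < m" "x $ i \<noteq> 0"
      using x(1,2) by (auto simp: vec_eq_iff)
    then have "y $ (i * m + i) \<noteq> 0"
      using lt'[OF i(1) i(1)] by (simp add: y_def)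
    then show ?thesis using lt'[OF i(1) i(1)] by auto
  qed
  ultimately have "eigenvalue (complex_mat K) (\<mu> * cnj \<mu>)"
    using y K by (auto simp: eigenvalue_def eigenvector_def)
  then have "algebraic_int (\<mu> * cnj \<mu>)"
    by (rule eigenvalue_algebraic_int[OF K])
  then have "algebraic_int (complex_of_real ((norm \<mu>)\<^sup>2))"
    by (simp only: complex_norm_square)
  then have "algebraic_int (sqrt ((norm \<mu>)\<^sup>2))"
    by (intro algebraic_int_sqrt) (simp only: algebraic_int_of_real_iff)
  then show ?thesis by simp
qed

text \<open>A nonzero integer vector has norm at least \<open>1\<close>, which excludes growth rates that tend to
  \<open>0\<close>.\<close>

lemma integer_matrix_growth:
  fixes B :: "int mat"
  assumes B: "B \<in> carrier_mat m m" and det: "det B \<noteq> 0" and x: "x \<in> carrier_vec m" "x \<noteq> 0\<^sub>v m"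
  shows "\<exists>l p. algebraic_int l \<and> l \<ge> 1 \<and>
    (\<lambda>n. \<Sum>i<m. \<bar>real_of_int ((B ^\<^sub>m n *\<^sub>v x) $ i)\<bar>) \<simeq> poly_exp p l"
proof -
  let ?M = "complex_mat B" and ?x = "map_vec of_int x :: complex vec"
  let ?a = "\<lambda>n. \<Sum>i<m. \<bar>real_of_int ((B ^\<^sub>m n *\<^sub>v x) $ i)\<bar>"
  have M: "?M \<in> carrier_mat m m" "?x \<in> carrier_vec m" using B x by auto
  have "det ?M \<noteq> 0" using det by (simp add: of_int_hom.hom_det)
  moreover have "?x \<noteq> 0\<^sub>v m"
    using x by (auto simp: vec_eq_iff)
  ultimately obtain \<mu> p where \<mu>: "eigenvalue ?M \<mu>" "\<mu> \<noteq> 0"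
    and p: "(\<lambda>n. l1_norm (?M ^\<^sub>m n *\<^sub>v ?x)) \<simeq> poly_exp p (norm \<mu>)"
    using matrix_power_growth[OF M(1) _ M(2)] by blast
  have "l1_norm (?M ^\<^sub>m n *\<^sub>v ?x) = ?a n" for n
  proof -
    have Bn: "B ^\<^sub>m n \<in> carrier_mat m m" using B by (rule pow_carrier_mat)
    have "map_vec of_int (B ^\<^sub>m n *\<^sub>v x) = complex_mat (B ^\<^sub>m n) *\<^sub>v ?x"
      by (rule of_int_hom.mult_mat_vec_hom[OF Bn x(1)])
    also have "complex_mat (B ^\<^sub>m n) = ?M ^\<^sub>m n"
      by (rule of_int_hom.mat_hom_pow[OF B])
    finally have "?M ^\<^sub>m n *\<^sub>v ?x = map_vec of_int (B ^\<^sub>m n *\<^sub>v x)" ..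
    then show ?thesis
      using Bn B by (simp add: l1_norm_def del: index_mult_mat_vec)
  qed
  with p have a: "?a \<simeq> poly_exp p (norm \<mu>)" by simp
  have pos: "norm \<mu> > 0" using \<mu> by simp
  have "?a n \<ge> 1" for n
  proof -
    obtain C where "C > 0" "poly_exp p (norm \<mu>) n \<le> C * ?a n"
      using a unfolding growth_eq_def growth_le_def by blast
    then have "?a n > 0"
      using poly_exp_pos[OF pos, of p n] by (metis less_le_trans zero_less_mult_pos)
    moreover obtain z where "?a n = real_of_int z"
      using that[of "\<Sum>i<m. \<bar>(B ^\<^sub>m n *\<^sub>v x) $ i\<bar>"] by simp
    ultimately show ?thesis by simp
  qed
  then have 1: "(\<lambda>n. 1) \<preceq> ?a" by (rule growth_le_mono)
  have "norm \<mu> \<ge> 1"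
  proof (rule ccontr)
    assume "\<not> norm \<mu> \<ge> 1"
    define s where "s = (norm \<mu> + 1) / 2"
    have s: "norm \<mu> < s" "s < 1" using \<open>\<not> norm \<mu> \<ge> 1\<close> by (auto simp: s_def)
    note 1
    also have "?a \<preceq> poly_exp p (norm \<mu>)" using a by (simp add: growth_eq_def)
    also have "\<dots> \<preceq> poly_exp 0 s" using pos s(1) by (rule poly_exp_le_smaller_base)
    finally obtain C where C: "C > 0" "\<And>n. 1 \<le> C * poly_exp 0 s n"
      unfolding growth_le_def by blast
    obtain n where n: "s ^ n < 1 / C"
      using real_arch_pow_inv[of "1 / C" s] C(1) s(2) by auto
    have "poly_exp 0 s n = s ^ n" by (simp add: poly_exp_def)
    then show False using n C(1) C(2)[of n] by (simp add: field_simps)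
  qed
  then show ?thesis
    using a norm_eigenvalue_algebraic_int[OF B \<mu>(1)] by blast
qed

section \<open>Bases of torsion-free abelian groups\<close>

context comm_group
begin

definition combination :: "('i \<Rightarrow> 'a) \<Rightarrow> 'i set \<Rightarrow> ('i \<Rightarrow> int) \<Rightarrow> 'a" where
  "combination t I x = finprod G (\<lambda>i. t i [^] x i) I"

lemma combination_closed [simp]: "t \<in> I \<rightarrow> carrier G \<Longrightarrow> combination t I x \<in> carrier G"
  unfolding combination_def by (intro finprod_closed) auto

lemma combination_empty [simp]: "combination t {} x = \<one>"
  by (simp add: combination_def)

lemma combination_insert:
  assumes "finite I" "i \<notin> I" "t \<in> insert i I \<rightarrow> carrier G"
  shows "combination t (insert i I) x = t i [^] x i \<otimes> combination t I x"
  unfolding combination_def using assms by (intro finprod_insert) auto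

lemma combination_cong:
  assumes "t \<in> I \<rightarrow> carrier G" "\<And>i. i \<in> I \<Longrightarrow> s i = t i" "\<And>i. i \<in> I \<Longrightarrow> x i = y i"
  shows "combination s I x = combination t I y"
  unfolding combination_def using assms by (intro finprod_cong') auto

lemma combination_zero:
  assumes "\<And>i. i \<in> I \<Longrightarrow> x i = 0"
  shows "combination t I x = \<one>"
  unfolding combination_def using assms by (intro finprod_one_eqI) auto

lemma combination_add:
  assumes "finite I" "t \<in> I \<rightarrow> carrier G"
  shows "combination t I (\<lambda>i. x i + y i) = combination t I x \<otimes> combination t I y"
proof -
  have "combination t I (\<lambda>i. x i + y i) = finprod G (\<lambda>i. t i [^] x i \<otimes> t i [^] y i) I"
    unfolding combination_def using assms(2) by (intro finprod_cong') (auto simp: int_pow_mult Pi_iff)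
  also have "\<dots> = combination t I x \<otimes> combination t I y"
    unfolding combination_def using assms(2) by (intro finprod_multf) auto
  finally show ?thesis .
qed

lemma combination_pow:
  assumes "finite I" "t \<in> I \<rightarrow> carrier G"
  shows "combination t I x [^] (k::int) = combination t I (\<lambda>i. x i * k)"
  using assms
proof (induction I)
  case (insert i I)
  then have t: "t i \<in> carrier G" "t \<in> I \<rightarrow> carrier G" by auto
  then show ?case
    using insert by (simp add: combination_insert int_pow_distrib int_pow_pow)
qed simp

lemma combination_single:
  assumes "finite I" "t \<in> I \<rightarrow> carrier G" "i \<in> I" "\<And>j. j \<in> I - {i} \<Longrightarrow> x j = 0"
  shows "combination t I x = t i [^] x i"
proof -
  have ti: "t i \<in> carrier G" using assms by auto
  have "combination t (insert i (I - {i})) x = t i [^] x i \<otimes> combination t (I - {i}) x"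
    using assms by (intro combination_insert) auto
  moreover have "combination t (I - {i}) x = \<one>"
    using assms(4) by (rule combination_zero)
  ultimately show ?thesis
    using assms(3) ti by (simp add: insert_absorb)
qed

definition spanning :: "('i \<Rightarrow> 'a) \<Rightarrow> 'i set \<Rightarrow> bool" where
  "spanning t I \<longleftrightarrow> finite I \<and> t \<in> I \<rightarrow> carrier G \<and> carrier G \<subseteq> range (combination t I)"

lemma finite_generating_set_spanning:
  assumes "finite_generating_set G S"
  shows "spanning id S"
proof -
  have fin: "finite S" "S \<subseteq> carrier G" "generate G S = carrier G"
    using assms by (auto simp: finite_generating_set_def)
  have t: "id \<in> S \<rightarrow> carrier G" using fin by auto
  have "h \<in> range (combination id S)" if "h \<in> generate G S" for h
    using that
  proof induction
    case one
    show ?case using combination_zero[of S "\<lambda>_. 0" id] by (metis rangeI)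
  next
    case (incl h)
    then have "combination id S (\<lambda>i. if i = h then 1 else 0) = h"
      using fin t by (subst combination_single[of _ _ h]) (auto simp: int_pow_1)
    then show ?case by (metis rangeI)
  next
    case (inv h)
    then have "combination id S (\<lambda>i. if i = h then -1 else 0) = inv h"
      using fin t by (subst combination_single[of _ _ h]) (auto simp: int_pow_neg int_pow_1)
    then show ?case by (metis rangeI)
  next
    case (eng h1 h2)
    then obtain x y where "h1 = combination id S x" "h2 = combination id S y" by blast
    then have "h1 \<otimes> h2 = combination id S (\<lambda>i. x i + y i)"
      by (simp add: combination_add[OF fin(1) t])
    then show ?case by blast
  qed
  then show ?thesis using fin t by (auto simp: spanning_def)
qed

text \<open>A change of the family that leaves its span unchanged: the new \<open>j\<close>-th member contains the
  \<open>i\<close>-th one \<open>s\<close> times, which the \<open>i\<close>-th coefficient compensates.\<close>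

lemma combination_transvection:
  assumes "finite I" "t \<in> I \<rightarrow> carrier G" "i \<in> I" "j \<in> I" "i \<noteq> j"
  shows "combination (t(j := t j \<otimes> t i [^] (s::int))) I (x(i := x i - s * x j)) = combination t I x"
proof -
  let ?K = "I - {i, j}" and ?t = "t(j := t j \<otimes> t i [^] s)" and ?x = "x(i := x i - s * x j)"
  have I: "I = insert i (insert j ?K)" using assms by auto
  have ti: "t i \<in> carrier G" "t j \<in> carrier G" using assms by auto
  have rest: "combination ?t ?K ?x = combination t ?K x"
    using assms(2) by (intro combination_cong) auto
  have R: "combination t ?K x \<in> carrier G" using assms(2) by (intro combination_closed) auto
  have "combination ?t (insert i (insert j ?K)) ?x =
      t i [^] (x i - s * x j) \<otimes> ((t j \<otimes> t i [^] s) [^] x j \<otimes> combination t ?K x)"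
    using assms ti by (subst combination_insert; (subst combination_insert)?) (auto simp: rest)
  also have "(t j \<otimes> t i [^] s) [^] x j = t j [^] x j \<otimes> t i [^] (s * x j)"
    using ti by (simp add: int_pow_distrib int_pow_pow)
  also have "t i [^] (x i - s * x j) \<otimes> (t j [^] x j \<otimes> t i [^] (s * x j) \<otimes> combination t ?K x) =
      (t i [^] (x i - s * x j) \<otimes> t i [^] (s * x j)) \<otimes> (t j [^] x j \<otimes> combination t ?K x)"
    using ti R by (simp add: m_ac)
  also have "t i [^] (x i - s * x j) \<otimes> t i [^] (s * x j) = t i [^] x i"
    using ti by (simp flip: int_pow_mult)
  also have "t i [^] x i \<otimes> (t j [^] x j \<otimes> combination t ?K x) = combination t (insert i (insert j ?K)) x"
    using assms ti by (subst combination_insert; (subst combination_insert)?) auto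
  finally show ?thesis unfolding I[symmetric] .
qed

text \<open>A Euclidean algorithm on the coefficients of a relation: as long as two of them are nonzero, a
  transvection makes the relation smaller. A single nonzero coefficient means that a member of the
  family has finite order, hence is trivial and can be left out.\<close>

lemma spanning_reduce:
  assumes torsion_free: "torsion G = {\<one>}"
    and "spanning t I" "combination t I a = \<one>" "i \<in> I" "a i \<noteq> 0"
  shows "\<exists>s J. spanning s J \<and> J \<subset> I"
  using assms(2-)
proof (induction "\<Sum>i\<in>I. nat \<bar>a i\<bar>" arbitrary: t a i rule: less_induct)
  case less
  have fin: "finite I" and t: "t \<in> I \<rightarrow> carrier G" and span: "carrier G \<subseteq> range (combination t I)"
    using less.prems by (auto simp: spanning_def)
  show ?case
  proof (cases "\<exists>j\<in>I. j \<noteq> i \<and> a j \<noteq> 0")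
    case False
    have ti: "t i \<in> carrier G" using t less.prems by auto
    have pow: "t i [^] a i = \<one>"
      using False less.prems fin t by (subst combination_single[symmetric]) auto
    have "t i [^] \<bar>a i\<bar> = \<one>"
      using ti pow by (simp add: abs_if int_pow_neg)
    then have "t i [^] int (nat \<bar>a i\<bar>) = \<one>" by simp
    then have "t i [^] nat \<bar>a i\<bar> = \<one>" by (simp only: int_pow_int)
    then have "t i \<in> torsion G"
      using ti less.prems(4) by (auto simp: torsion_def intro!: exI[of _ "nat \<bar>a i\<bar>"])
    then have one: "t i = \<one>" using torsion_free by simp
    have drop: "combination t I x = combination t (I - {i}) x" for x
      using combination_insert[of "I - {i}" i t x] fin t less.prems(3)
      by (simp add: insert_absorb one int_pow_one Pi_iff)
    then have "range (combination t I) = range (combination t (I - {i}))"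
      by (simp add: image_def)
    then have "spanning t (I - {i})"
      using fin t span by (auto simp: spanning_def)
    then show ?thesis using less.prems(3) by blast
  next
    case True
    have reduce: ?thesis if ij: "i \<in> I" "j \<in> I" "i \<noteq> j" "a i \<noteq> 0" "a j \<noteq> 0" "\<bar>a j\<bar> \<le> \<bar>a i\<bar>" for i j
    proof -
      define s where "s = sgn (a i) * sgn (a j)"
      let ?t = "t(j := t j \<otimes> t i [^] s)" and ?a = "a(i := a i - s * a j)"
      note transvection = combination_transvection[OF fin t ij(1-3)]
      have "spanning ?t I"
        unfolding spanning_def
      proof (intro conjI fin subsetI)
        show "?t \<in> I \<rightarrow> carrier G" using t ij by (auto simp: Pi_iff)
        fix h assume "h \<in> carrier G"
        then obtain x where "h = combination t I x" using span by auto
        then have "h = combination ?t I (x(i := x i - s * x j))"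
          using transvection by simp
        then show "h \<in> range (combination ?t I)" by blast
      qed
      moreover have "combination ?t I ?a = \<one>"
        using transvection less.prems(2) by simp
      moreover have "(\<Sum>i\<in>I. nat \<bar>?a i\<bar>) < (\<Sum>i\<in>I. nat \<bar>a i\<bar>)"
      proof (rule sum_strict_mono_ex1[OF fin])
        have "\<bar>a i - s * a j\<bar> < \<bar>a i\<bar>"
          using ij(4-6) by (auto simp: s_def sgn_if abs_if split: if_splits)
        then show "\<forall>k\<in>I. nat \<bar>?a k\<bar> \<le> nat \<bar>a k\<bar>" "\<exists>k\<in>I. nat \<bar>?a k\<bar> < nat \<bar>a k\<bar>"
          using ij(1) by auto
      qed
      moreover have "?a j \<noteq> 0" using ij by simp
      ultimately show ?thesis using less.hyps ij(2) by blast
    qed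
    obtain j where j: "j \<in> I" "j \<noteq> i" "a j \<noteq> 0" using True by blast
    show ?thesis
    proof (cases "\<bar>a j\<bar> \<le> \<bar>a i\<bar>")
      case True
      then show ?thesis
        using j less.prems(3,4) by (intro reduce[of i j]) auto
    next
      case False
      then show ?thesis
        using j less.prems(3,4) by (intro reduce[of j i]) auto
    qed
  qed
qed

definition basis :: "('i \<Rightarrow> 'a) \<Rightarrow> 'i set \<Rightarrow> bool" where
  "basis t I \<longleftrightarrow> spanning t I \<and> (\<forall>x. combination t I x = \<one> \<longrightarrow> (\<forall>i\<in>I. x i = 0))"

text \<open>A spanning family with as few members as possible is a basis.\<close>

lemma ex_basis:
  assumes "torsion G = {\<one>}" "finite_generating_set G S"
  shows "\<exists>(t :: 'a \<Rightarrow> 'a) I. basis t I"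
proof -
  have "\<exists>n I. card I = n \<and> (\<exists>t :: 'a \<Rightarrow> 'a. spanning t I)"
    using finite_generating_set_spanning[OF assms(2)] by blast
  from LeastI_ex[OF this] obtain I and t :: "'a \<Rightarrow> 'a"
    where I: "card I = (LEAST n. \<exists>I. card I = n \<and> (\<exists>t :: 'a \<Rightarrow> 'a. spanning t I))" "spanning t I"
    by blast
  have "x i = 0" if x: "combination t I x = \<one>" "i \<in> I" for x i
  proof (rule ccontr)
    assume "x i \<noteq> 0"
    then obtain s J where J: "spanning s J" "J \<subset> I"
      using spanning_reduce[OF assms(1) I(2) x] by blast
    then have "card J < card I"
      using I(2) by (intro psubset_card_mono) (auto simp: spanning_def)
    moreover have "card I \<le> card J"
      unfolding I(1) using J(1) by (intro Least_le) blast
    ultimately show False by simp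
  qed
  then show ?thesis using I(2) by (auto simp: basis_def)
qed

lemma basis_reindex:
  assumes "basis t I"
  shows "\<exists>s. basis s {..<card I}"
proof -
  have I: "finite I" "t \<in> I \<rightarrow> carrier G" "carrier G \<subseteq> range (combination t I)"
    using assms by (auto simp: basis_def spanning_def)
  obtain e where e: "bij_betw e {..<card I} I"
    using ex_bij_betw_nat_finite[OF I(1)] by (auto simp: atLeast0LessThan)
  then have eI: "e ` {..<card I} = I" and inj: "inj_on e {..<card I}"
    by (auto simp: bij_betw_def)
  have e_in: "e i \<in> I" if "i < card I" for i using eI that by blast
  have te: "t \<circ> e \<in> {..<card I} \<rightarrow> carrier G" using I(2) e_in by (auto simp: Pi_iff)
  have comb: "combination t I x = combination (t \<circ> e) {..<card I} (x \<circ> e)" for x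
  proof -
    have "(\<lambda>i. t i [^] x i) \<in> e ` {..<card I} \<rightarrow> carrier G" using I(2) eI by auto
    from finprod_reindex[OF this inj] show ?thesis
      by (simp add: combination_def eI)
  qed
  have "x i = 0" if x: "combination (t \<circ> e) {..<card I} x = \<one>" and i: "i < card I" for x i
  proof -
    let ?y = "x \<circ> inv_into {..<card I} e"
    have "combination t I ?y = combination (t \<circ> e) {..<card I} x"
      unfolding comb using te inj by (intro combination_cong) auto
    then have "combination t I ?y = \<one>" using x by simp
    then have "?y (e i) = 0"
      using assms e_in[OF i] unfolding basis_def by blast
    then show ?thesis using inj i by simp
  qed
  moreover have "carrier G \<subseteq> range (combination (t \<circ> e) {..<card I})"
    using I(3) comb by auto
  ultimately have "basis (t \<circ> e) {..<card I}"
    using te by (auto simp: basis_def spanning_def)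
  then show ?thesis by blast
qed

lemma wlen_pow_mult:
  assumes S: "finite_generating_set G S" and t: "t \<in> carrier G" and c: "c \<in> carrier G"
  shows "wlen G S (t [^] (k::int) \<otimes> c) \<le> real_of_int \<bar>k\<bar> * (wlen G S t + wlen G S (inv t)) + wlen G S c"
proof -
  have nat: "wlen G S (u [^] (n::nat) \<otimes> c) \<le> real n * wlen G S u + wlen G S c" if u: "u \<in> carrier G" for u n
  proof (induction n)
    case (Suc n)
    have "wlen G S (u [^] Suc n \<otimes> c) = wlen G S (u \<otimes> (u [^] n \<otimes> c))"
      using u c by (simp add: m_ac)
    also have "\<dots> \<le> wlen G S u + wlen G S (u [^] n \<otimes> c)"
      using S u c by (intro wlen_mult) auto
    finally show ?case using Suc by (simp add: algebra_simps)
  qed (use c in simp)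
  have pos: "wlen G S t \<ge> 0" "wlen G S (inv t) \<ge> 0"
    using wlen_ge_1[OF S, of t] wlen_ge_1[OF S, of "inv t"] t by auto
  show ?thesis
  proof (cases "k \<ge> 0")
    case True
    then obtain n where n: "k = int n" using nonneg_eq_int by blast
    have "real n * wlen G S t \<le> real n * (wlen G S t + wlen G S (inv t))"
      using pos by (intro mult_left_mono) auto
    then show ?thesis using nat[OF t, of n] by (simp add: n int_pow_int)
  next
    case False
    then obtain n where n: "k = - int n" using nonpos_int_cases[of k] by auto
    have eq: "t [^] k = inv t [^] n"
      using t by (simp add: n int_pow_neg int_pow_int nat_pow_inv)
    have "real n * wlen G S (inv t) \<le> real n * (wlen G S t + wlen G S (inv t))"
      using pos by (intro mult_left_mono) auto
    then show ?thesis using nat[of "inv t" n] t unfolding eq by (simp add: n)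
  qed
qed

lemma wlen_combination_le:
  assumes S: "finite_generating_set G S" and t: "t \<in> I \<rightarrow> carrier G" and fin: "finite I"
  shows "wlen G S (combination t I x) \<le>
    1 + (\<Sum>i\<in>I. real_of_int \<bar>x i\<bar> * (wlen G S (t i) + wlen G S (inv (t i))))"
  using fin t
proof (induction I)
  case empty
  then show ?case by (simp add: wlen_def)
next
  case (insert i I)
  then have "wlen G S (combination t (insert i I) x) \<le>
      real_of_int \<bar>x i\<bar> * (wlen G S (t i) + wlen G S (inv (t i))) + wlen G S (combination t I x)"
    unfolding combination_insert[OF insert.hyps insert.prems] by (intro wlen_pow_mult[OF S]) auto
  then show ?case using insert by auto
qed

text \<open>A combination is a word whose length is bounded by its coefficients, and conversely the norm of
  the coordinates is subadditive.\<close>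

lemma wlen_combination_growth:
  assumes S: "finite_generating_set G S" and basis: "basis t I"
    and x: "\<And>n::nat. combination t I (x n) \<noteq> \<one>"
  shows "(\<lambda>n. wlen G S (combination t I (x n))) \<simeq> (\<lambda>n. \<Sum>i\<in>I. \<bar>real_of_int (x n i)\<bar>)"
proof -
  let ?w = "\<lambda>n. wlen G S (combination t I (x n))" and ?l = "\<lambda>n. \<Sum>i\<in>I. \<bar>real_of_int (x n i)\<bar>"
  have I: "finite I" "t \<in> I \<rightarrow> carrier G" "carrier G \<subseteq> range (combination t I)"
    and indep: "\<And>x i. combination t I x = \<one> \<Longrightarrow> i \<in> I \<Longrightarrow> x i = 0"
    using basis by (auto simp: basis_def spanning_def)
  have coord_unique: "x i = y i" if eq: "combination t I x = combination t I y" and i: "i \<in> I" for x y i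
  proof -
    have "combination t I (\<lambda>i. x i + y i * -1) = combination t I x \<otimes> combination t I y [^] (-1::int)"
      using I by (simp only: combination_add combination_pow)
    also have "\<dots> = \<one>" using I eq by (simp add: int_pow_neg int_pow_1)
    finally show ?thesis using indep[OF _ i] by force
  qed
  have l_ge_1: "?l n \<ge> 1" for n
  proof -
    obtain i where i: "i \<in> I" "x n i \<noteq> 0"
      using x[of n] combination_zero[of I "x n" t] by blast
    have "1 \<le> \<bar>real_of_int (x n i)\<bar>" using i(2) by linarith
    also have "\<dots> \<le> ?l n" using i(1) I(1) by (intro member_le_sum) auto
    finally show ?thesis .
  qed
  define M where "M i = wlen G S (t i) + wlen G S (inv (t i))" for i
  have M: "M i \<ge> 0" if "i \<in> I" for i
    using that I(2) wlen_ge_1[OF S, of "t i"] wlen_ge_1[OF S, of "inv (t i)"] by (auto simp: M_def Pi_iff)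
  have "?w n \<le> (1 + sum M I) * ?l n" for n
  proof -
    have "?w n \<le> 1 + (\<Sum>i\<in>I. \<bar>real_of_int (x n i)\<bar> * M i)"
      using wlen_combination_le[OF S I(2,1)] by (simp add: M_def)
    also have "(\<Sum>i\<in>I. \<bar>real_of_int (x n i)\<bar> * M i) \<le> (\<Sum>i\<in>I. ?l n * M i)"
      using M I(1) by (intro sum_mono mult_right_mono member_le_sum) auto
    also have "\<dots> = ?l n * sum M I" by (simp add: sum_distrib_left)
    also have "1 + ?l n * sum M I \<le> (1 + sum M I) * ?l n"
      using l_ge_1[of n] by (simp add: algebra_simps)
    finally show ?thesis by simp
  qed
  moreover have "1 + sum M I > 0" using M by (intro add_pos_nonneg sum_nonneg) auto
  ultimately have "?w \<preceq> ?l" by (rule growth_leI[rotated])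
  moreover have "?l \<preceq> ?w"
  proof -
    define c where "c h = (SOME x. combination t I x = h)" for h
    have c: "combination t I (c h) = h" if h: "h \<in> carrier G" for h
    proof -
      obtain x where "combination t I x = h" using I(3) h by blast
      then show ?thesis unfolding c_def by (rule someI[of "\<lambda>y. combination t I y = h"])
    qed
    define f where "f h = (\<Sum>i\<in>I. \<bar>real_of_int (c h i)\<bar>)" for h
    have f: "f (combination t I x) = (\<Sum>i\<in>I. \<bar>real_of_int (x i)\<bar>)" for x
      unfolding f_def using coord_unique[OF c] I by (intro sum.cong) auto
    have "f (g \<otimes> h) \<le> f g + f h" if "g \<in> carrier G" "h \<in> carrier G" for g h
    proof -
      have "g \<otimes> h = combination t I (\<lambda>i. c g i + c h i)"
        using that c I by (simp add: combination_add)
      then have "f (g \<otimes> h) = (\<Sum>i\<in>I. \<bar>real_of_int (c g i + c h i)\<bar>)" by (simp add: f)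
      also have "\<dots> \<le> (\<Sum>i\<in>I. \<bar>real_of_int (c g i)\<bar> + \<bar>real_of_int (c h i)\<bar>)"
        by (intro sum_mono) auto
      finally show ?thesis by (simp add: f_def sum.distrib)
    qed
    from subadditive_le_wlen[OF S this]
    obtain C where "C > 0" "\<And>h. h \<in> carrier G \<Longrightarrow> f h \<le> C * wlen G S h" by blast
    then show ?thesis using I(2) by (intro growth_leI[of C]) (auto simp flip: f)
  qed
  ultimately show ?thesis unfolding growth_eq_def by blast
qed

lemma hom_combination:
  fixes t :: "nat \<Rightarrow> 'a"
  assumes f: "f \<in> hom G G" and t: "t \<in> {..<m} \<rightarrow> carrier G" and J: "J \<subseteq> {..<m}"
    and b: "\<And>j. j < m \<Longrightarrow> f (t j) = combination t {..<m} (b j)"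
  shows "f (combination t J x) = combination t {..<m} (\<lambda>i. \<Sum>j\<in>J. b j i * x j)"
proof -
  interpret f: group_hom G G f using f by unfold_locales
  have "finite J" using J finite_subset by blast
  then show ?thesis using J
  proof (induction J)
    case empty
    then show ?case by (simp add: combination_zero)
  next
    case (insert j J)
    then have j: "j < m" "t j \<in> carrier G" "t \<in> J \<rightarrow> carrier G" using t by auto
    have "f (combination t (insert j J) x) = f (t j) [^] x j \<otimes> f (combination t J x)"
      using insert j by (simp add: combination_insert f.hom_int_pow)
    also have "f (t j) [^] x j = combination t {..<m} (\<lambda>i. b j i * x j)"
      using t by (simp add: b[OF j(1)] combination_pow)
    also have "f (combination t J x) = combination t {..<m} (\<lambda>i. \<Sum>j\<in>J. b j i * x j)"
      using insert by auto
    finally show ?case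
      using insert t by (simp add: combination_add)
  qed
qed

text \<open>In a basis an injective endomorphism becomes multiplication by a nonsingular integer matrix.\<close>

lemma injective_endomorphism_growth:
  assumes torsion_free: "torsion G = {\<one>}" and f: "f \<in> hom G G" "inj_on f (carrier G)"
    and h: "h \<in> carrier G"
  shows "\<exists>l p. algebraic_int l \<and> l \<ge> 1 \<and>
    (\<forall>S. finite_generating_set G S \<longrightarrow> (\<lambda>n. wlen G S ((f ^^ n) h)) \<simeq> poly_exp p l)"
proof (cases "h = \<one> \<or> (\<nexists>S. finite_generating_set G S)")
  case True
  \<comment> \<open>The rate has to be chosen before the generating set. If there is none, any rate will do.\<close>
  interpret f: group_hom G G f using f by unfold_locales
  have "(f ^^ n) \<one> = \<one>" for n by (induction n) auto
  moreover have "(\<lambda>n. 1) = poly_exp 0 1" by (auto simp: poly_exp_def)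
  ultimately show ?thesis
    using True by (intro exI[of _ 1] exI[of _ 0]) (auto simp: wlen_def growth_eq_refl)
next
  case False
  interpret f: group_hom G G f using f by unfold_locales
  obtain t :: "nat \<Rightarrow> 'a" and m where basis: "basis t {..<m}"
    using False ex_basis[OF torsion_free] basis_reindex by metis
  then have t: "t \<in> {..<m} \<rightarrow> carrier G" and span: "carrier G \<subseteq> range (combination t {..<m})"
    and indep: "\<And>x i. combination t {..<m} x = \<one> \<Longrightarrow> i < m \<Longrightarrow> x i = 0"
    by (auto simp: basis_def spanning_def)
  define ev where "ev x = combination t {..<m} (\<lambda>i. x $ i)" for x
  have "\<exists>b. \<forall>j<m. f (t j) = combination t {..<m} (b j)"
  proof -
    have "\<forall>j<m. \<exists>b. f (t j) = combination t {..<m} b"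
      using t span by (fastforce simp: Pi_iff image_iff subset_iff)
    then show ?thesis by metis
  qed
  then obtain b where b: "\<And>j. j < m \<Longrightarrow> f (t j) = combination t {..<m} (b j)" by blast
  define B where "B = mat m m (\<lambda>(i, j). b j i)"
  have B: "B \<in> carrier_mat m m" by (simp add: B_def)
  have f_ev: "f (ev x) = ev (B *\<^sub>v x)" if x: "x \<in> carrier_vec m" for x
  proof -
    have "f (ev x) = combination t {..<m} (\<lambda>i. \<Sum>j<m. b j i * x $ j)"
      unfolding ev_def using f(1) t b by (intro hom_combination) auto
    also have "\<dots> = ev (B *\<^sub>v x)"
      unfolding ev_def
    proof (rule combination_cong[OF t])
      fix i assume "i \<in> {..<m}"
      then have "(B *\<^sub>v x) $ i = (\<Sum>j<m. B $$ (i, j) * x $ j)"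
        by (intro index_mult_mat_vec_sum[OF B x]) simp
      also have "\<dots> = (\<Sum>j<m. b j i * x $ j)"
        using \<open>i \<in> {..<m}\<close> by (simp add: B_def)
      finally show "(\<Sum>j<m. b j i * x $ j) = (B *\<^sub>v x) $ i" ..
    qed simp
    finally show ?thesis .
  qed
  have ev_closed: "ev x \<in> carrier G" for x unfolding ev_def using t by simp
  have ev_eq_one: "x = 0\<^sub>v m" if "x \<in> carrier_vec m" "ev x = \<one>" for x
    using indep[of "\<lambda>i. x $ i"] that by (auto simp: ev_def)
  have "det B \<noteq> 0"
  proof
    assume "det B = 0"
    then obtain x where x: "x \<in> carrier_vec m" "x \<noteq> 0\<^sub>v m" "B *\<^sub>v x = 0\<^sub>v m"
      using det_0_iff_vec_prod_zero[OF B] by blast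
    have "ev (0\<^sub>v m) = \<one>" unfolding ev_def by (intro combination_zero) auto
    then have "f (ev x) = f \<one>" using f_ev[OF x(1)] x(3) by simp
    then have "ev x = \<one>" using inj_onD[OF f(2) _ ev_closed one_closed] by blast
    then show False using ev_eq_one x by blast
  qed
  obtain x where x: "x \<in> carrier_vec m" "h = ev x"
  proof -
    obtain y where "h = combination t {..<m} y" using span h by blast
    also have "\<dots> = ev (vec m y)" unfolding ev_def using t by (intro combination_cong) auto
    finally show ?thesis by (intro that[of "vec m y"]) auto
  qed
  have "x \<noteq> 0\<^sub>v m"
  proof
    assume "x = 0\<^sub>v m"
    then have "h = \<one>" unfolding x(2) ev_def by (intro combination_zero) auto
    then show False using False by blast
  qed
  have Bn: "B ^\<^sub>m n *\<^sub>v x \<in> carrier_vec m" for n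
    using B x(1) by (intro mult_mat_vec_carrier[of _ m m] pow_carrier_mat)
  have iter: "(f ^^ n) h = ev (B ^\<^sub>m n *\<^sub>v x)" for n
  proof (induction n)
    case 0
    then show ?case using B x by simp
  next
    case (Suc n)
    have Bpow: "B ^\<^sub>m n \<in> carrier_mat m m" for n using B by (rule pow_carrier_mat)
    have "B ^\<^sub>m Suc n = B * B ^\<^sub>m n"
    proof (induction n)
      case (Suc n)
      have "B ^\<^sub>m Suc (Suc n) = (B * B ^\<^sub>m n) * B" using Suc by simp
      also have "\<dots> = B * B ^\<^sub>m Suc n" using assoc_mult_mat[OF B Bpow B] by simp
      finally show ?case .
    qed (use B in simp)
    then have "B ^\<^sub>m Suc n *\<^sub>v x = B *\<^sub>v (B ^\<^sub>m n *\<^sub>v x)"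
      using assoc_mult_mat_vec[OF B Bpow x(1)] by simp
    then show ?case using Suc f_ev[OF Bn] by simp
  qed
  have "(f ^^ n) h \<noteq> \<one>" for n
  proof (induction n)
    case 0
    then show ?case using False by simp
  next
    case (Suc n)
    have "(f ^^ n) h \<in> carrier G" unfolding iter by (rule ev_closed)
    then have "f ((f ^^ n) h) \<noteq> f \<one>" using inj_onD[OF f(2) _ _ one_closed] Suc by blast
    then show ?case by simp
  qed
  then have ne: "combination t {..<m} (\<lambda>i. (B ^\<^sub>m n *\<^sub>v x) $ i) \<noteq> \<one>" for n
    unfolding iter ev_def .
  obtain l p where lp: "algebraic_int l" "l \<ge> 1"
    "(\<lambda>n. \<Sum>i<m. \<bar>real_of_int ((B ^\<^sub>m n *\<^sub>v x) $ i)\<bar>) \<simeq> poly_exp p l"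
    using integer_matrix_growth[OF B \<open>det B \<noteq> 0\<close> x(1) \<open>x \<noteq> 0\<^sub>v m\<close>] by blast
  have "(\<lambda>n. wlen G S ((f ^^ n) h)) \<simeq> poly_exp p l" if S: "finite_generating_set G S" for S
    unfolding iter ev_def
    using wlen_combination_growth[OF S basis ne] lp(3) by (rule growth_eq_trans)
  then show ?thesis using lp by blast
qed

end


section \<open>Growth under automorphisms of a direct product\<close>

lemma ab_map_iso:
  assumes "group G" "\<chi> \<in> auto G"
  shows "ab_map \<chi> \<in> iso (free_ab G) (free_ab G)"
proof -
  interpret group G by fact
  let ?D = "derived G (carrier G)" and ?Ab = "abelianisation G"
  interpret Ab: comm_group ?Ab by (rule comm_group_abelianisation)
  have iso: "\<chi> \<in> iso G G"
    using assms(2) by (auto simp: auto_def Bij_def iso_def)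
  then interpret \<chi>: group_hom G G \<chi>
    by unfold_locales (simp add: iso_def)
  have "\<chi> ` ?D = ?D"
    using \<chi>.derived_img[of "carrier G"] iso by (simp add: iso_iff)
  then have isoAb: "(\<lambda>C. \<chi> ` C) \<in> iso ?Ab ?Ab"
    unfolding abelianisation_def by (rule iso_FactGroup_image[OF derived_self_is_normal iso])
  have "(\<lambda>U. (\<lambda>C. \<chi> ` C) ` U) \<in> iso (free_ab G) (free_ab G)"
    unfolding free_ab_def
    by (rule iso_FactGroup_image[OF Ab.subgroup_imp_normal[OF Ab.subgroup_torsion] isoAb
          iso_image_torsion[OF Ab.is_group isoAb]])
  moreover have "ab_map \<chi> = (\<lambda>U. (\<lambda>C. \<chi> ` C) ` U)"
    by (simp add: ab_map_def fun_eq_iff)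
  ultimately show ?thesis by simp
qed

theorem corollary3p6:
  fixes k :: nat and Gs :: "nat \<Rightarrow> 'a monoid" and A :: "'b monoid"
    and G :: "((nat \<Rightarrow> 'a) \<times> 'b) monoid"
  assumes "\<And>i. i \<in> {1..k} \<Longrightarrow> group (Gs i)"
    and "\<And>i. i \<in> {1..k} \<Longrightarrow> directly_indecomposable (Gs i)"
    and "\<And>i. i \<in> {1..k} \<Longrightarrow> center (Gs i) = {\<one>\<^bsub>Gs i\<^esub>}"
    and "free_abelian A"
    and "G = product_with k Gs A"
    and "finitely_generated G"
  shows "(\<forall>\<phi>\<in>Aut0 k Gs A. \<exists>\<phi>s. (\<forall>i\<in>{1..k}. \<phi>s i \<in> auto (Gs i)) \<and>
            (\<forall>S Ss T. finite_generating_set G S \<longrightarrow>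
               (\<forall>i\<in>{1..k}. finite_generating_set (Gs i) (Ss i)) \<longrightarrow>
               finite_generating_set (free_ab G) T \<longrightarrow>
               (\<forall>gs a. (gs, a) \<in> carrier G \<longrightarrow>
                  (\<lambda>n. wlen G S ((\<phi> ^^ n) (gs, a))) \<simeq>
                    (\<lambda>n. (\<Sum>i=1..k. wlen (Gs i) (Ss i) ((\<phi>s i ^^ n) (gs i))) +
                         wlen (free_ab G) T ((ab_map \<phi> ^^ n) (ab_elem G (gs, a)))) \<and>
                  (\<lambda>n. clen G S ((\<phi> ^^ n) (gs, a))) \<simeq>
                    (\<lambda>n. (\<Sum>i=1..k. clen (Gs i) (Ss i) ((\<phi>s i ^^ n) (gs i))) +
                         wlen (free_ab G) T ((ab_map \<phi> ^^ n) (ab_elem G (gs, a)))))))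
       \<and> (\<forall>\<phi>\<in>Aut0 k Gs A. \<forall>g\<in>carrier G. \<exists>(l::real) (p::nat). algebraic_int l \<and> l \<ge> 1 \<and>
            (\<forall>T. finite_generating_set (free_ab G) T \<longrightarrow>
               (\<lambda>n. wlen (free_ab G) T ((ab_map \<phi> ^^ n) (ab_elem G g))) \<simeq>
                 (\<lambda>n. if n = 0 then 1 else real n ^ p * l ^ n)))"
proof -
  interpret direct_product k Gs A
    using assms(1) free_abelian_comm_group[OF assms(4)] by (rule direct_product.intro)
  have G: "G = P" by (rule assms(5))
  have torsion_free: "torsion A = {\<one>\<^bsub>A\<^esub>}"
    using assms(4) by (rule free_abelian_torsion_free)
  show ?thesis
    unfolding G
  proof (intro conjI ballI)
    fix \<phi> assume \<phi>: "\<phi> \<in> Aut0 k Gs A"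
    then have auto: "\<phi> \<in> auto P" by (simp add: Aut0_def)
    show "\<exists>\<phi>s. (\<forall>i\<in>{1..k}. \<phi>s i \<in> auto (Gs i)) \<and>
            (\<forall>S Ss T. finite_generating_set P S \<longrightarrow>
               (\<forall>i\<in>{1..k}. finite_generating_set (Gs i) (Ss i)) \<longrightarrow>
               finite_generating_set (free_ab P) T \<longrightarrow>
               (\<forall>gs a. (gs, a) \<in> carrier P \<longrightarrow>
                  (\<lambda>n. wlen P S ((\<phi> ^^ n) (gs, a))) \<simeq>
                    (\<lambda>n. (\<Sum>i=1..k. wlen (Gs i) (Ss i) ((\<phi>s i ^^ n) (gs i))) +
                         wlen (free_ab P) T ((ab_map \<phi> ^^ n) (ab_elem P (gs, a)))) \<and>
                  (\<lambda>n. clen P S ((\<phi> ^^ n) (gs, a))) \<simeq>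
                    (\<lambda>n. (\<Sum>i=1..k. clen (Gs i) (Ss i) ((\<phi>s i ^^ n) (gs i))) +
                         wlen (free_ab P) T ((ab_map \<phi> ^^ n) (ab_elem P (gs, a))))))"
    proof (intro exI[of _ "component_aut \<phi>"] conjI ballI allI impI)
      show "component_aut \<phi> i \<in> auto (Gs i)" if "i \<in> {1..k}" for i
        using \<phi> assms(3) that by (rule component_aut_auto)
    next
      fix S Ss T gs a
      assume S: "finite_generating_set P S"
        and "\<forall>i\<in>{1..k}. finite_generating_set (Gs i) (Ss i)"
        and T: "finite_generating_set (free_ab P) T" and g: "(gs, a) \<in> carrier P"
      then have Ss: "\<And>i. i \<in> {1..k} \<Longrightarrow> finite_generating_set (Gs i) (Ss i)" by blast
      let ?x = "\<lambda>n. (\<phi> ^^ n) (gs, a)"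
      have x: "?x n \<in> carrier P" for n
        using funpow_Aut0_closed[OF \<phi> assms(3) g] .
      have comp: "(component_aut \<phi> i ^^ n) (gs i) = fst (?x n) i" if "i \<in> {1..k}" for i n
        using funpow_Aut0_component[OF \<phi> assms(3) that g] by simp
      have ab: "(ab_map \<phi> ^^ n) (ab_elem P (gs, a)) = ab_elem P (?x n)" for n
        by (rule funpow_ab_map_ab_elem[OF group_P auto g])
      show "(\<lambda>n. wlen P S (?x n)) \<simeq>
          (\<lambda>n. (\<Sum>i=1..k. wlen (Gs i) (Ss i) ((component_aut \<phi> i ^^ n) (gs i))) +
               wlen (free_ab P) T ((ab_map \<phi> ^^ n) (ab_elem P (gs, a))))"
        using wlen_growth_le_components[OF S Ss T torsion_free x] wlen_growth_components_le[OF S Ss T x]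
        by (simp add: growth_eq_def ab comp)
      show "(\<lambda>n. clen P S (?x n)) \<simeq>
          (\<lambda>n. (\<Sum>i=1..k. clen (Gs i) (Ss i) ((component_aut \<phi> i ^^ n) (gs i))) +
               wlen (free_ab P) T ((ab_map \<phi> ^^ n) (ab_elem P (gs, a))))"
        using clen_growth_le_components[OF S Ss T torsion_free x] clen_growth_components_le[OF S Ss T x]
        by (simp add: growth_eq_def ab comp)
    qed
  next
    fix \<phi> g assume \<phi>: "\<phi> \<in> Aut0 k Gs A" and g: "g \<in> carrier P"
    then have "ab_map \<phi> \<in> iso (free_ab P) (free_ab P)"
      by (intro ab_map_iso group_P) (simp add: Aut0_def)
    then have iso: "ab_map \<phi> \<in> hom (free_ab P) (free_ab P)" "inj_on (ab_map \<phi>) (carrier (free_ab P))"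
      by (auto simp: iso_iff)
    have "ab_elem P g \<in> carrier (free_ab P)"
      using P.ab_elem_hom g by (rule hom_in_carrier)
    from comm_group.injective_endomorphism_growth[OF P.comm_group_free_ab P.torsion_free_free_ab iso this]
    obtain l p where "algebraic_int l" "l \<ge> 1" and
      growth: "\<And>T. finite_generating_set (free_ab P) T \<Longrightarrow>
        (\<lambda>n. wlen (free_ab P) T ((ab_map \<phi> ^^ n) (ab_elem P g))) \<simeq> poly_exp p l"
      by blast
    moreover have "poly_exp p l = (\<lambda>n. if n = 0 then 1 else real n ^ p * l ^ n)"
      by (simp add: fun_eq_iff poly_exp_def)
    ultimately show "\<exists>(l::real) (p::nat). algebraic_int l \<and> l \<ge> 1 \<and>
            (\<forall>T. finite_generating_set (free_ab P) T \<longrightarrow>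
               (\<lambda>n. wlen (free_ab P) T ((ab_map \<phi> ^^ n) (ab_elem P g))) \<simeq>
                 (\<lambda>n. if n = 0 then 1 else real n ^ p * l ^ n))"
      by auto
  qed
qed

end
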